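(* Suppose: (a) $u_0\in H^3(\Omega)\cap H_0^1(\Omega)$ and $b_n:=(u_0,\phi_n)\ge0$ for all $n\in\mathbb{N}^+$; (b) there is $\theta\in(0,1)$ with $F\in C^\theta([0,T];H^3(\Omega)\cap H_0^1(\Omega))$, and $F_n(t):=(F(\cdot,t),\phi_n)\ge0$ on $[0,T]$ for all $n\in\mathbb{N}^+$; (c) there is $N\in\mathbb{N}^+$ with $\frac{\partial\phi_N}{\partial\mathbf{n}}(x_0)>0$, $b_N>0$ and $F_N(t)>0$ on $[0,T]$; (d) $g\in C^+[0,T]$. If $a_1,a_2\in\mathcal{D}(K)$ satisfy $a_1\le a_2$ on $[0,T]$, then $Ka_1\le Ka_2$ on $[0,T]$.
   Context: $T>0$, $\alpha\in(0,1)$, and $\Omega\subset\mathbb{R}^d$, $d\in\{1,2,3\}$, is bounded with $C^3$ boundary; $x_0\in\partial\Omega$ is fixed and $\frac{\partial}{\partial\mathbf{n}}$ is the normal derivative on $\partial\Omega$. $-\mathcal{L}u=-\sum_{i,j=1}^d(a^{ij}(x)u_{x_i})_{x_j}+c(x)u$ is a symmetric uniformly elliptic operator with $a^{ij},c\in C^2(\overline\Omega)$. Its Dirichlet eigenpairs are $(\lambda_n,\phi_n)$, $n\in\mathbb{N}^+$, with $0<\lambda_1\le\lambda_2\le\cdots\to\infty$ ($\lambda_1>0$ is a standing assumption), and $\{\phi_n\}\subset H^3(\Omega)\cap H_0^1(\Omega)\subset C^1(\overline\Omega)$ is an orthonormal basis of $L^2(\Omega)$, with signs chosen so that $\frac{\partial\phi_n}{\partial\mathbf{n}}(x_0)\ge0$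 for all $n$. $(\cdot,\cdot)$ is the inner product of $L^2(\Omega)$. $C^+[0,T]=\{\psi\in C[0,T]:\psi>0\text{ on }[0,T]\}$. $I_t^\alpha v(t)=\frac{1}{\Gamma(\alpha)}\int_0^t(t-\tau)^{\alpha-1}v(\tau)\,d\tau$. The Caputo derivative is $^C\!D_t^{\alpha}f(t)=\frac{1}{\Gamma(1-\alpha)}\int_0^t(t-\tau)^{-\alpha}f'(\tau)\,d\tau$; for $f$ merely continuous it is understood as $\frac{d}{dt}\frac{1}{\Gamma(1-\alpha)}\int_0^t(t-\tau)^{-\alpha}(f(\tau)-f(0))\,d\tau$. For $\psi\in C^+[0,T]$, $u_n(\cdot;\psi)\in C[0,T]$ is the unique solution (with $^C\!D_t^{\alpha}u_n\in C[0,T]$) of $^C\!D_t^{\alpha}u_n+\lambda_n\psi(t)u_n=F_n(t)$, $u_n(0;\psi)=b_n$; $u(x,t;\psi)=\sum_{n}u_n(t;\psi)\phi_n(x)$ is the weak solution of $^C\!D_t^{\alpha}u-\psi(t)\mathcal{L}u=F$ with zero Dirichlet data and $u(x,0)=u_0$. The operator $K$ is $$K\psi(t)=\frac{g(t)}{\frac{\partial u}{\partial\mathbf{n}}(x_0,t;\psi)}=\frac{g(t)}{\sum_{n=1}^\infty u_n(t;\psi)\frac{\partial\phi_n}{\partial\mathbf{n}}(x_0)},\quad t\in[0,T],$$ with domain $\mathcal{D}(K)=\big\{\psi\in C^+[0,T]:\psi(t)\ge g(t)\big[\tfrac{\partial u_0}{\partial\mathbf{n}}(x_0)+I_t^\alpha[\tfrac{\partial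 F}{\partial\mathbf{n}}(x_0,t)]\big]^{-1},\ t\in[0,T]\big\}$. *)

theory Defs
  imports "HOL-Analysis.Analysis"
begin

section \<open>Classical differentiability classes\<close>

definition partial_deriv :: "'d::finite \<Rightarrow> (real^'d \<Rightarrow> real) \<Rightarrow> real^'d \<Rightarrow> real" where
  "partial_deriv i f x = deriv (\<lambda>s. f (x + s *\<^sub>R axis i 1)) 0"

definition grad :: "(real^'d::finite \<Rightarrow> real) \<Rightarrow> real^'d \<Rightarrow> real^'d" where
  "grad f x = (\<chi> i. partial_deriv i f x)"

text \<open>Iterated partial derivatives are indexed by lists of directions instead of multi-indices.\<close>

definition partial_derivs :: "'d::finite list \<Rightarrow> (real^'d \<Rightarrow> real) \<Rightarrow> real^'d \<Rightarrow> real" where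
  "partial_derivs js f = foldr partial_deriv js f"

text \<open>\<open>Ck k S f\<close>: \<open>f\<close> is of class \<open>C\<^sup>k\<close> on \<open>S\<close>; meant for open \<open>S\<close> only.\<close>

primrec Ck :: "nat \<Rightarrow> (real^'d::finite) set \<Rightarrow> (real^'d \<Rightarrow> real) \<Rightarrow> bool" where
  "Ck 0 S f \<longleftrightarrow> continuous_on S f"
| "Ck (Suc k) S f \<longleftrightarrow> (\<forall>x\<in>S. f differentiable (at x)) \<and> (\<forall>i. Ck k S (partial_deriv i f))"

definition Ck_closure :: "nat \<Rightarrow> (real^'d::finite) set \<Rightarrow> (real^'d \<Rightarrow> real) \<Rightarrow> bool" where
  "Ck_closure k \<Omega> f \<longleftrightarrow> continuous_on (closure \<Omega>) f \<and> Ck k \<Omega> f \<and>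
     (\<forall>js. length js \<le> k \<longrightarrow>
        (\<exists>h. continuous_on (closure \<Omega>) h \<and> (\<forall>x\<in>\<Omega>. h x = partial_derivs js f x)))"

definition test_functions :: "(real^'d::finite) set \<Rightarrow> (real^'d \<Rightarrow> real) set" where
  "test_functions \<Omega> = {\<eta>. (\<forall>k. Ck k UNIV \<eta>) \<and> compact (closure {x. \<eta> x \<noteq> 0}) \<and>
     closure {x. \<eta> x \<noteq> 0} \<subseteq> \<Omega>}"


section \<open>Domains with \<open>C\<^sup>3\<close> boundary and the outer normal\<close>

text \<open>Near \<open>p\<close>, the set \<open>\<Omega>\<close> is the part of the ball on one side of the graph of the \<open>C\<^sup>3\<close> function
  \<open>\<gamma>\<close> over the coordinates other than \<open>x\<^sub>k\<close>. A function of these \<open>d - 1\<close> coordinates is encoded as a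
  function on the whole space that does not depend on \<open>x\<^sub>k\<close>; the sign \<open>\<sigma>\<close> gives the orientation of
  the \<open>k\<close>-th axis.\<close>

definition boundary_graph ::
    "(real^'d::finite) set \<Rightarrow> real^'d \<Rightarrow> real \<Rightarrow> 'd \<Rightarrow> real \<Rightarrow> (real^'d \<Rightarrow> real) \<Rightarrow> bool" where
  "boundary_graph \<Omega> p r k \<sigma> \<gamma> \<longleftrightarrow>
     r > 0 \<and> \<sigma> \<in> {-1, 1} \<and> Ck 3 UNIV \<gamma> \<and>
     (\<forall>x y. (\<forall>i. i \<noteq> k \<longrightarrow> x $ i = y $ i) \<longrightarrow> \<gamma> x = \<gamma> y) \<and>
     \<Omega> \<inter> ball p r = {x \<in> ball p r. \<gamma> x < \<sigma> * x $ k}"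

definition C3_domain :: "(real^'d::finite) set \<Rightarrow> bool" where
  "C3_domain \<Omega> \<longleftrightarrow> open \<Omega> \<and> bounded \<Omega> \<and>
     (\<forall>p\<in>frontier \<Omega>. \<exists>r k \<sigma> \<gamma>. boundary_graph \<Omega> p r k \<sigma> \<gamma>)"

definition outer_normal :: "(real^'d::finite) set \<Rightarrow> real^'d \<Rightarrow> real^'d" where
  "outer_normal \<Omega> p = (THE \<nu>. \<exists>r k \<sigma> \<gamma>. boundary_graph \<Omega> p r k \<sigma> \<gamma> \<and>
     \<nu> = sgn (grad \<gamma> p - \<sigma> *\<^sub>R axis k 1))"

text \<open>A function is identified with its class modulo null sets; its normal derivative at a boundary
  point is that of the representative in \<open>C\<^sup>1\<close> of the closure (which, for \<open>d \<le> 3\<close>, exists for every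
  function in \<open>H\<^sup>3\<close>), whose gradient extends continuously to the boundary.\<close>

definition normal_derivative :: "(real^'d::finite) set \<Rightarrow> real^'d \<Rightarrow> (real^'d \<Rightarrow> real) \<Rightarrow> real" where
  "normal_derivative \<Omega> p u = (THE r. \<exists>v. Ck_closure 1 \<Omega> v \<and>
     (AE x in lebesgue_on \<Omega>. v x = u x) \<and>
     ((\<lambda>x. grad v x \<bullet> outer_normal \<Omega> p) \<longlongrightarrow> r) (at p within \<Omega>))"


section \<open>Sobolev spaces\<close>

definition L2 :: "(real^'d::finite) set \<Rightarrow> (real^'d \<Rightarrow> real) set" where
  "L2 \<Omega> = {u \<in> borel_measurable (lebesgue_on \<Omega>). integrable (lebesgue_on \<Omega>) (\<lambda>x. (u x)\<^sup>2)}"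

definition L2_inner :: "(real^'d::finite) set \<Rightarrow> (real^'d \<Rightarrow> real) \<Rightarrow> (real^'d \<Rightarrow> real) \<Rightarrow> real" where
  "L2_inner \<Omega> u v = (LINT x|lebesgue_on \<Omega>. u x * v x)"

definition locally_integrable :: "(real^'d::finite) set \<Rightarrow> (real^'d \<Rightarrow> real) \<Rightarrow> bool" where
  "locally_integrable \<Omega> u \<longleftrightarrow> (\<forall>C. compact C \<and> C \<subseteq> \<Omega> \<longrightarrow> u absolutely_integrable_on C)"

definition weak_deriv ::
    "(real^'d::finite) set \<Rightarrow> 'd list \<Rightarrow> (real^'d \<Rightarrow> real) \<Rightarrow> (real^'d \<Rightarrow> real) \<Rightarrow> bool" where
  "weak_deriv \<Omega> js u v \<longleftrightarrow> locally_integrable \<Omega> u \<and> locally_integrable \<Omega> v \<and>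
     (\<forall>\<eta>\<in>test_functions \<Omega>.
        L2_inner \<Omega> u (partial_derivs js \<eta>) = (-1) ^ length js * L2_inner \<Omega> v \<eta>)"

definition sobolev_space :: "nat \<Rightarrow> (real^'d::finite) set \<Rightarrow> (real^'d \<Rightarrow> real) set" where
  "sobolev_space k \<Omega> = {u \<in> L2 \<Omega>. \<forall>js. length js \<le> k \<longrightarrow> (\<exists>v\<in>L2 \<Omega>. weak_deriv \<Omega> js u v)}"

text \<open>The weak derivative as a function is determined up to a null set only, which is immaterial for
  the norm.\<close>

definition weak_D :: "(real^'d::finite) set \<Rightarrow> 'd list \<Rightarrow> (real^'d \<Rightarrow> real) \<Rightarrow> real^'d \<Rightarrow> real" where
  "weak_D \<Omega> js u = (if js = [] then u else (SOME v. weak_deriv \<Omega> js u v))"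

text \<open>Summing over lists rather than multi-indices counts mixed derivatives with their multiplicity;
  the resulting norm is equivalent to the usual one.\<close>

definition sobolev_norm :: "nat \<Rightarrow> (real^'d::finite) set \<Rightarrow> (real^'d \<Rightarrow> real) \<Rightarrow> real" where
  "sobolev_norm k \<Omega> u =
     sqrt (\<Sum>js\<in>{js. length js \<le> k}. L2_inner \<Omega> (weak_D \<Omega> js u) (weak_D \<Omega> js u))"

text \<open>\<open>H\<^sub>0\<^sup>1\<close> is the closure of the test functions in \<open>H\<^sup>1\<close>.\<close>

definition H10 :: "(real^'d::finite) set \<Rightarrow> (real^'d \<Rightarrow> real) set" where
  "H10 \<Omega> = {u \<in> sobolev_space 1 \<Omega>.
     \<exists>\<eta>::nat \<Rightarrow> real^'d \<Rightarrow> real. (\<forall>n. \<eta> n \<in> test_functions \<Omega>) \<and>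
       (\<lambda>n. sobolev_norm 1 \<Omega> (\<lambda>x. u x - \<eta> n x)) \<longlonglongrightarrow> 0}"

text \<open>The space \<open>C\<^sup>\<theta>([0,T]; H\<^sup>3 \<inter> H\<^sub>0\<^sup>1)\<close>; the argument order of \<open>F\<close> is \<open>F x t\<close>.\<close>

definition holder_H3_H10 ::
    "real \<Rightarrow> real \<Rightarrow> (real^'d::finite) set \<Rightarrow> (real^'d \<Rightarrow> real \<Rightarrow> real) \<Rightarrow> bool" where
  "holder_H3_H10 \<theta> T \<Omega> F \<longleftrightarrow>
     (\<forall>t\<in>{0..T}. (\<lambda>x. F x t) \<in> sobolev_space 3 \<Omega> \<inter> H10 \<Omega>) \<and>
     (\<exists>C. \<forall>s\<in>{0..T}. \<forall>t\<in>{0..T}.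
        sobolev_norm 3 \<Omega> (\<lambda>x. F x t - F x s) \<le> C * \<bar>t - s\<bar> powr \<theta>)"


section \<open>The elliptic operator and its Dirichlet eigensystem\<close>

definition elliptic_coeffs ::
    "(real^'d::finite) set \<Rightarrow> ('d \<Rightarrow> 'd \<Rightarrow> real^'d \<Rightarrow> real) \<Rightarrow> (real^'d \<Rightarrow> real) \<Rightarrow> bool" where
  "elliptic_coeffs \<Omega> a c \<longleftrightarrow>
     (\<forall>i j. Ck_closure 2 \<Omega> (a i j)) \<and> Ck_closure 2 \<Omega> c \<and>
     (\<forall>x\<in>closure \<Omega>. \<forall>i j. a i j x = a j i x) \<and>
     (\<exists>\<mu>>0. \<forall>x\<in>closure \<Omega>. \<forall>\<xi>::real^'d.
        (\<Sum>i\<in>UNIV. \<Sum>j\<in>UNIV. a i j x * \<xi> $ i * \<xi> $ j) \<ge> \<mu> * (norm \<xi>)\<^sup>2)"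

text \<open>\<open>neg_L \<Omega> a c u f\<close>: \<open>-\<Sum>\<^sub>i\<^sub>j (a\<^sub>i\<^sub>j u\<^sub>x\<^sub>i)\<^sub>x\<^sub>j + c u = f\<close> almost everywhere in \<open>\<Omega>\<close>, with weak derivatives.\<close>

definition neg_L ::
    "(real^'d::finite) set \<Rightarrow> ('d \<Rightarrow> 'd \<Rightarrow> real^'d \<Rightarrow> real) \<Rightarrow> (real^'d \<Rightarrow> real) \<Rightarrow>
      (real^'d \<Rightarrow> real) \<Rightarrow> (real^'d \<Rightarrow> real) \<Rightarrow> bool" where
  "neg_L \<Omega> a c u f \<longleftrightarrow> (\<exists>D W.
     (\<forall>i. weak_deriv \<Omega> [i] u (D i)) \<and>
     (\<forall>i j. weak_deriv \<Omega> [j] (\<lambda>x. a i j x * D i x) (W i j)) \<and>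
     (AE x in lebesgue_on \<Omega>. f x = - (\<Sum>i\<in>UNIV. \<Sum>j\<in>UNIV. W i j x) + c x * u x))"

definition orthonormal_basis_L2 ::
    "(real^'d::finite) set \<Rightarrow> (nat \<Rightarrow> real^'d \<Rightarrow> real) \<Rightarrow> bool" where
  "orthonormal_basis_L2 \<Omega> \<phi> \<longleftrightarrow>
     (\<forall>n. \<phi> n \<in> L2 \<Omega>) \<and>
     (\<forall>m n. L2_inner \<Omega> (\<phi> m) (\<phi> n) = (if m = n then 1 else 0)) \<and>
     (\<forall>f\<in>L2 \<Omega>. (\<lambda>M. LINT x|lebesgue_on \<Omega>.
        (f x - (\<Sum>n<M. L2_inner \<Omega> f (\<phi> n) * \<phi> n x))\<^sup>2) \<longlonglongrightarrow> 0)"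

text \<open>Eigenpairs are numbered from \<open>0\<close> instead of \<open>1\<close>, and the signs of the eigenfunctions are
  normalised by their normal derivatives at \<open>x0\<close>.\<close>

definition dirichlet_eigensystem ::
    "(real^'d::finite) set \<Rightarrow> ('d \<Rightarrow> 'd \<Rightarrow> real^'d \<Rightarrow> real) \<Rightarrow> (real^'d \<Rightarrow> real) \<Rightarrow> real^'d \<Rightarrow>
      (nat \<Rightarrow> real) \<Rightarrow> (nat \<Rightarrow> real^'d \<Rightarrow> real) \<Rightarrow> bool" where
  "dirichlet_eigensystem \<Omega> a c x0 lam \<phi> \<longleftrightarrow>
     0 < lam 0 \<and> incseq lam \<and> filterlim lam at_top sequentially \<and>
     (\<forall>n. \<phi> n \<in> sobolev_space 3 \<Omega> \<inter> H10 \<Omega>) \<and>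
     (\<forall>n. neg_L \<Omega> a c (\<phi> n) (\<lambda>x. lam n * \<phi> n x)) \<and>
     orthonormal_basis_L2 \<Omega> \<phi> \<and>
     (\<forall>n. normal_derivative \<Omega> x0 (\<phi> n) \<ge> 0)"


section \<open>Fractional calculus\<close>

definition frac_int :: "real \<Rightarrow> (real \<Rightarrow> real) \<Rightarrow> real \<Rightarrow> real" where
  "frac_int \<beta> v t = 1 / Gamma \<beta> * (LINT \<tau>:{0..t}|lborel. (t - \<tau>) powr (\<beta> - 1) * v \<tau>)"

text \<open>\<open>h\<close> is the Caputo derivative of order \<open>\<alpha>\<close> of the continuous function \<open>f\<close> on \<open>[0,T]\<close>, that is,
  the derivative (one-sided at \<open>0\<close> and \<open>T\<close>) of the fractional integral of order \<open>1 - \<alpha>\<close> of \<open>f - f 0\<close>.\<close>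

definition has_caputo_deriv :: "real \<Rightarrow> real \<Rightarrow> (real \<Rightarrow> real) \<Rightarrow> (real \<Rightarrow> real) \<Rightarrow> bool" where
  "has_caputo_deriv \<alpha> T f h \<longleftrightarrow> (\<forall>t\<in>{0..T}.
     (frac_int (1 - \<alpha>) (\<lambda>\<tau>. f \<tau> - f 0) has_real_derivative h t) (at t within {0..T}))"

definition solves_frac_ode ::
    "real \<Rightarrow> real \<Rightarrow> real \<Rightarrow> (real \<Rightarrow> real) \<Rightarrow> (real \<Rightarrow> real) \<Rightarrow> real \<Rightarrow> (real \<Rightarrow> real) \<Rightarrow> bool" where
  "solves_frac_ode \<alpha> T l \<psi> f b v \<longleftrightarrow> continuous_on {0..T} v \<and> v 0 = b \<and>
     (\<exists>h. continuous_on {0..T} h \<and> has_caputo_deriv \<alpha> T v h \<and>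
        (\<forall>t\<in>{0..T}. h t + l * \<psi> t * v t = f t))"

text \<open>The unique solution on \<open>[0,T]\<close>; \<open>extensional\<close> fixes the irrelevant values outside \<open>[0,T]\<close>.\<close>

definition frac_ode_sol ::
    "real \<Rightarrow> real \<Rightarrow> real \<Rightarrow> (real \<Rightarrow> real) \<Rightarrow> (real \<Rightarrow> real) \<Rightarrow> real \<Rightarrow> real \<Rightarrow> real" where
  "frac_ode_sol \<alpha> T l \<psi> f b =
     (THE v. v \<in> extensional {0..T} \<and> solves_frac_ode \<alpha> T l \<psi> f b v)"


section \<open>The operator \<open>K\<close>\<close>

definition Cplus :: "real \<Rightarrow> (real \<Rightarrow> real) set" where
  "Cplus T = {\<psi>. continuous_on {0..T} \<psi> \<and> (\<forall>t\<in>{0..T}. \<psi> t > 0)}"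

definition u_mode ::
    "real \<Rightarrow> real \<Rightarrow> (real^'d::finite) set \<Rightarrow> (nat \<Rightarrow> real) \<Rightarrow> (nat \<Rightarrow> real^'d \<Rightarrow> real) \<Rightarrow>
      (real^'d \<Rightarrow> real) \<Rightarrow> (real^'d \<Rightarrow> real \<Rightarrow> real) \<Rightarrow> nat \<Rightarrow> (real \<Rightarrow> real) \<Rightarrow> real \<Rightarrow> real" where
  "u_mode \<alpha> T \<Omega> lam \<phi> u0 F n \<psi> =
     frac_ode_sol \<alpha> T (lam n) \<psi> (\<lambda>t. L2_inner \<Omega> (\<lambda>x. F x t) (\<phi> n)) (L2_inner \<Omega> u0 (\<phi> n))"

text \<open>The flux series \<open>\<Sum>\<^sub>n u\<^sub>n(t;\<psi>) \<partial>\<phi>\<^sub>n/\<partial>n(x0)\<close> is summed in the extended reals. In the situation of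
  interest its terms are nonnegative, so the sum always exists; if it diverged, the quotient would be \<open>0\<close>
  (\<open>real_of_ereal \<infinity> = 0\<close> and division by \<open>0\<close>), in agreement with \<open>1/\<infinity> = 0\<close>. Whenever the series converges, this is the ordinary quotient of real numbers
  (\<open>K_op_real\<close> below).\<close>

definition K_op ::
    "real \<Rightarrow> real \<Rightarrow> (real^'d::finite) set \<Rightarrow> real^'d \<Rightarrow> (nat \<Rightarrow> real) \<Rightarrow> (nat \<Rightarrow> real^'d \<Rightarrow> real) \<Rightarrow>
      (real^'d \<Rightarrow> real) \<Rightarrow> (real^'d \<Rightarrow> real \<Rightarrow> real) \<Rightarrow> (real \<Rightarrow> real) \<Rightarrow> (real \<Rightarrow> real) \<Rightarrow> real \<Rightarrow> real" where
  "K_op \<alpha> T \<Omega> x0 lam \<phi> u0 F g \<psi> t = g t / real_of_ereal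
     (\<Sum>n. ereal (u_mode \<alpha> T \<Omega> lam \<phi> u0 F n \<psi> t * normal_derivative \<Omega> x0 (\<phi> n)))"

lemma K_op_real:
  assumes "summable (\<lambda>n. u_mode \<alpha> T \<Omega> lam \<phi> u0 F n \<psi> t * normal_derivative \<Omega> x0 (\<phi> n))"
  shows "K_op \<alpha> T \<Omega> x0 lam \<phi> u0 F g \<psi> t =
    g t / (\<Sum>n. u_mode \<alpha> T \<Omega> lam \<phi> u0 F n \<psi> t * normal_derivative \<Omega> x0 (\<phi> n))"
  using assms unfolding K_op_def by (simp add: suminf_ereal')

definition K_domain ::
    "real \<Rightarrow> real \<Rightarrow> (real^'d::finite) set \<Rightarrow> real^'d \<Rightarrow> (real^'d \<Rightarrow> real) \<Rightarrow>
      (real^'d \<Rightarrow> real \<Rightarrow> real) \<Rightarrow> (real \<Rightarrow> real) \<Rightarrow> (real \<Rightarrow> real) set" where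
  "K_domain \<alpha> T \<Omega> x0 u0 F g = {\<psi> \<in> Cplus T. \<forall>t\<in>{0..T}.
     \<psi> t \<ge> g t * inverse (normal_derivative \<Omega> x0 u0 +
        frac_int \<alpha> (\<lambda>\<tau>. normal_derivative \<Omega> x0 (\<lambda>x. F x \<tau>)) t)}"

end

theory Submission
  imports Defs
begin

text \<open>
  The numerator of \<open>K\<psi>\<close> does not depend on \<open>\<psi>\<close>, so it suffices that the positive flux series decreases
  termwise: \<open>0 \<le> u\<^sub>n(\<cdot>;a\<^sub>2) \<le> u\<^sub>n(\<cdot>;a\<^sub>1)\<close>. The difference \<open>w\<close> of the two modes satisfies a fractional
  equation with zero initial value and source \<open>\<lambda>\<^sub>n(a\<^sub>2 - a\<^sub>1)u\<^sub>n(\<cdot>;a\<^sub>2)\<close>, hence everything rests on a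
  comparison principle for the fractional equation.

  A merely continuous solution is not regular enough for the usual extremum principle of the Caputo
  derivative. The equation is therefore rewritten as \<open>w = b + I\<^sup>\<alpha>h\<close> with \<open>h\<close> continuous. Turning off \<open>h\<close>
  after a time \<open>p\<close>, the continuation of \<open>w - b\<close> is a sub-average of its past, with an explicit
  nonnegative kernel; so \<open>w\<close> cannot reach zero at a point where \<open>h > 0\<close>. Applied to differences, the
  same principle gives uniqueness of the modes; existence follows from Banach's fixed point theorem.
\<close>

section \<open>Abel kernels\<close>

lemma nn_integral_Beta_complement:
  fixes \<alpha> :: real
  assumes "0 < \<alpha>" "\<alpha> < 1"
  shows "(\<integral>\<^sup>+x. ennreal (x powr (\<alpha> - 1) * (1 - x) powr (-\<alpha>) * indicator {0..1} x) \<partial>lborel)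
    = ennreal (Gamma \<alpha> * Gamma (1 - \<alpha>))"
proof -
  have "((\<lambda>t. t powr (\<alpha> - 1) * (1 - t) powr (1 - \<alpha> - 1)) has_integral Beta \<alpha> (1 - \<alpha>)) {0..1}"
    using assms by (intro has_integral_Beta_real) auto
  from nn_integral_has_integral_lebesgue'[OF _ this]
  have "(\<integral>\<^sup>+x. ennreal (x powr (\<alpha> - 1) * (1 - x) powr (-\<alpha>)) * indicator {0..1} x \<partial>lborel)
    = ennreal (Gamma \<alpha> * Gamma (1 - \<alpha>))"
    by (simp add: Beta_def)
  then show ?thesis
    by (simp add: ennreal_mult' ennreal_indicator)
qed

lemma nn_integral_abel_semigroup:
  fixes \<alpha> \<sigma> t :: real
  assumes "0 < \<alpha>" "\<alpha> < 1" "\<sigma> < t"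
  shows "(\<integral>\<^sup>+s. ennreal ((t - s) powr (-\<alpha>) * (s - \<sigma>) powr (\<alpha> - 1) * indicator {\<sigma>..t} s) \<partial>lborel)
    = ennreal (Gamma \<alpha> * Gamma (1 - \<alpha>))"
proof -
  let ?f = "\<lambda>x::real. x powr (\<alpha> - 1) * (1 - x) powr (-\<alpha>)"
  let ?g = "\<lambda>s. (s - \<sigma>) / (t - \<sigma>)"
  have "ennreal (Gamma \<alpha> * Gamma (1 - \<alpha>)) = (\<integral>\<^sup>+x. ennreal (?f x * indicator {?g \<sigma>..?g t} x) \<partial>lborel)"
    using nn_integral_Beta_complement[OF assms(1,2)] assms(3) by simp
  also have "\<dots> = (\<integral>\<^sup>+s. ennreal (?f (?g s) * (1 / (t - \<sigma>)) * indicator {\<sigma>..t} s) \<partial>lborel)"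
    using assms
    by (intro nn_integral_substitution)
       (auto simp: set_borel_measurable_def intro!: derivative_eq_intros continuous_intros)
  also have "\<dots> = (\<integral>\<^sup>+s. ennreal ((t - s) powr (-\<alpha>) * (s - \<sigma>) powr (\<alpha> - 1) * indicator {\<sigma>..t} s) \<partial>lborel)"
  proof (intro nn_integral_cong, goal_cases)
    case (1 s)
    show ?case
    proof (cases "s \<in> {\<sigma>..t}")
      case True
      let ?d = "t - \<sigma>"
      have *: "1 - ?g s = (t - s) / ?d" using assms by (simp add: field_simps)
      have "?f (?g s) * (1 / ?d) =
          (s - \<sigma>) powr (\<alpha> - 1) * (t - s) powr (-\<alpha>) / (?d powr (\<alpha> - 1) * ?d powr (-\<alpha>) * ?d powr 1)"
        using True assms unfolding * by (simp add: powr_divide)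
      also have "?d powr (\<alpha> - 1) * ?d powr (-\<alpha>) * ?d powr 1 = 1"
        using assms by (simp only: powr_add[symmetric]) simp
      finally show ?thesis by (simp add: mult.commute)
    qed simp
  qed
  finally show ?thesis by simp
qed

text \<open>If \<open>h\<close> is cut off after time \<open>p\<close>, the value of \<open>I\<^sup>\<alpha>h\<close> at a later time \<open>t\<close> is an average of its
  values on \<open>[0,p]\<close> against the following nonnegative kernel, of total mass at most \<open>1\<close>.\<close>

definition abel_poisson :: "real \<Rightarrow> real \<Rightarrow> real \<Rightarrow> real \<Rightarrow> real" where
  "abel_poisson \<alpha> p t s = (t - p) powr \<alpha> * (p - s) powr (-\<alpha>) / (t - s) / (Gamma \<alpha> * Gamma (1 - \<alpha>))"

lemma abel_poisson_measurable [measurable]: "abel_poisson \<alpha> p t \<in> borel_measurable borel"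
  unfolding abel_poisson_def by measurable

lemma abel_poisson_nonneg:
  assumes "0 < \<alpha>" "\<alpha> < 1" "s < t"
  shows "0 \<le> abel_poisson \<alpha> p t s"
  using assms by (simp add: abel_poisson_def less_imp_le Gamma_real_pos)

lemma nn_integral_abel_poisson:
  fixes \<alpha> \<sigma> p t :: real
  assumes "0 < \<alpha>" "\<alpha> < 1" "\<sigma> < p" "p < t"
  shows "(\<integral>\<^sup>+s. ennreal (abel_poisson \<alpha> p t s * (s - \<sigma>) powr (\<alpha> - 1) * indicator {\<sigma>..p} s) \<partial>lborel)
    = ennreal ((t - \<sigma>) powr (\<alpha> - 1))"
proof -
  let ?G = "Gamma \<alpha> * Gamma (1 - \<alpha>)"
  let ?f = "\<lambda>x::real. x powr (\<alpha> - 1) * (1 - x) powr (-\<alpha>)"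
  \<comment> \<open>a Moebius map from \<open>[\<sigma>,p]\<close> onto \<open>[0,1]\<close> with pole \<open>t\<close> reduces the integral to the Beta integral\<close>
  let ?g = "\<lambda>s. (s - \<sigma>) * (t - p) / ((p - \<sigma>) * (t - s))"
  let ?g' = "\<lambda>s. (t - p) * (t - \<sigma>) / ((p - \<sigma>) * (t - s)\<^sup>2)"
  have G: "?G > 0" using assms by (simp add: Gamma_real_pos)
  have Gne: "Gamma \<alpha> \<noteq> 0" "Gamma (1 - \<alpha>) \<noteq> 0" using G by auto
  have "ennreal ?G = (\<integral>\<^sup>+x. ennreal (?f x * indicator {?g \<sigma>..?g p} x) \<partial>lborel)"
    using nn_integral_Beta_complement[OF assms(1,2)] assms(3,4) by simp
  also have "\<dots> = (\<integral>\<^sup>+s. ennreal (?f (?g s) * ?g' s * indicator {\<sigma>..p} s) \<partial>lborel)"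
  proof (rule nn_integral_substitution)
    show "(?g has_real_derivative ?g' s) (at s)" if "s \<in> {\<sigma>..p}" for s
    proof -
      have nz: "t - s \<noteq> 0" "p - \<sigma> \<noteq> 0" using that assms by auto
      have num: "(t - p) * ((p - \<sigma>) * (t - s)) - (s - \<sigma>) * (t - p) * (- (p - \<sigma>))
          = (p - \<sigma>) * ((t - p) * (t - \<sigma>))"
        by (simp add: algebra_simps)
      have "(?g has_real_derivative ((t - p) * ((p - \<sigma>) * (t - s)) - (s - \<sigma>) * (t - p) * (- (p - \<sigma>)))
          / ((p - \<sigma>) * (t - s) * ((p - \<sigma>) * (t - s)))) (at s)"
        using nz by (intro DERIV_divide) (auto intro!: derivative_eq_intros)
      then show ?thesis
        unfolding num using nz by (simp add: power2_eq_square mult_ac)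
    qed
  qed (use assms in \<open>auto simp: set_borel_measurable_def intro!: continuous_intros\<close>)
  also have "\<dots> = (\<integral>\<^sup>+s. ennreal (?G * (t - \<sigma>) powr (1 - \<alpha>)) *
      ennreal (abel_poisson \<alpha> p t s * (s - \<sigma>) powr (\<alpha> - 1) * indicator {\<sigma>..p} s) \<partial>lborel)"
  proof (intro nn_integral_cong, goal_cases)
    case (1 s)
    show ?case
    proof (cases "s \<in> {\<sigma>..p}")
      case True
      define a b c d e where "a = s - \<sigma>" "b = t - p" "c = p - \<sigma>" "d = t - s" "e = p - s"
      define h where "h = t - \<sigma>"
      have pos: "a \<ge> 0" "b > 0" "c > 0" "d > 0" "e \<ge> 0" "h > 0"
        using True assms by (auto simp: a_b_c_d_e_def h_def)
      have "1 - ?g s = e * h / (c * d)"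
        using pos unfolding a_b_c_d_e_def h_def by (simp add: divide_simps) (simp add: algebra_simps)
      then have "?f (?g s) * ?g' s = (a * b / (c * d)) powr (\<alpha> - 1) * (e * h / (c * d)) powr (-\<alpha>) * (b * h / (c * d\<^sup>2))"
        unfolding a_b_c_d_e_def h_def by simp
      also have "\<dots> = a powr (\<alpha> - 1) * e powr (-\<alpha>) * ((b powr (\<alpha> - 1) * b powr 1) * (h powr (-\<alpha>) * h powr 1)) /
          ((c powr (\<alpha> - 1) * c powr (-\<alpha>) * c powr 1) * (d powr (\<alpha> - 1) * d powr (-\<alpha>) * d powr 1) * d)"
        using pos by (simp add: powr_divide powr_mult power2_eq_square mult_ac)
      also have "\<dots> = a powr (\<alpha> - 1) * e powr (-\<alpha>) * (b powr \<alpha> * h powr (1 - \<alpha>)) / d"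
        using pos by (simp only: powr_add[symmetric]) simp
      also have "\<dots> = (?G * h powr (1 - \<alpha>)) * (abel_poisson \<alpha> p t s * a powr (\<alpha> - 1))"
        using Gne unfolding abel_poisson_def a_b_c_d_e_def h_def by simp
      finally have "?f (?g s) * ?g' s = (?G * (t - \<sigma>) powr (1 - \<alpha>)) * (abel_poisson \<alpha> p t s * (s - \<sigma>) powr (\<alpha> - 1))"
        unfolding a_b_c_d_e_def h_def .
      moreover have "0 \<le> abel_poisson \<alpha> p t s"
        using True assms by (intro abel_poisson_nonneg) auto
      ultimately show ?thesis using True G by (simp add: ennreal_mult)
    qed simp
  qed
  also have "\<dots> = ennreal (?G * (t - \<sigma>) powr (1 - \<alpha>)) * 
      (\<integral>\<^sup>+s. ennreal (abel_poisson \<alpha> p t s * (s - \<sigma>) powr (\<alpha> - 1) * indicator {\<sigma>..p} s) \<partial>lborel)"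
    (is "_ = _ * ?I") by (intro nn_integral_cmult) measurable
  finally have eq: "ennreal ?G = ennreal (?G * (t - \<sigma>) powr (1 - \<alpha>)) * ?I" .
  let ?c = "(t - \<sigma>) powr (\<alpha> - 1) / ?G" and ?d = "?G * (t - \<sigma>) powr (1 - \<alpha>)"
  have "0 \<le> ?c" "0 \<le> ?d" using G by (auto simp del: zero_less_mult_iff)
  have "ennreal ?c * ennreal ?G = ennreal ?c * (ennreal ?d * ?I)"
    by (rule arg_cong[OF eq])
  also have "\<dots> = ennreal (?c * ?d) * ?I"
    unfolding ennreal_mult[OF \<open>0 \<le> ?c\<close> \<open>0 \<le> ?d\<close>] by (simp only: mult.assoc)
  finally have "ennreal ?c * ennreal ?G = ennreal (?c * ?d) * ?I" .
  moreover have "(t - \<sigma>) powr (\<alpha> - 1) / ?G * (?G * (t - \<sigma>) powr (1 - \<alpha>)) = 1"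
    using Gne assms by (simp add: powr_add[symmetric])
  ultimately show ?thesis
    using G Gne ennreal_mult[OF \<open>0 \<le> ?c\<close> less_imp_le[OF G]] by simp
qed

lemma nn_integral_abel_poisson_le_1:
  fixes \<alpha> \<sigma> p t :: real
  assumes "0 < \<alpha>" "\<alpha> < 1" "\<sigma> < p" "p < t"
  shows "(\<integral>\<^sup>+s. ennreal (abel_poisson \<alpha> p t s * indicator {\<sigma>..p} s) \<partial>lborel) \<le> 1"
proof -
  have "(\<integral>\<^sup>+s. ennreal (abel_poisson \<alpha> p t s * indicator {\<sigma>..p} s) \<partial>lborel)
     \<le> (\<integral>\<^sup>+s. ennreal ((t - \<sigma>) powr (1 - \<alpha>)) * 
        ennreal (abel_poisson \<alpha> p t s * (s - \<sigma>) powr (\<alpha> - 1) * indicator {\<sigma>..p} s) \<partial>lborel)"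
  proof (rule nn_integral_mono_AE)
    have "AE s in lborel. s \<noteq> \<sigma>" by (rule AE_lborel_singleton)
    then show "AE s in lborel. ennreal (abel_poisson \<alpha> p t s * indicator {\<sigma>..p} s)
      \<le> ennreal ((t - \<sigma>) powr (1 - \<alpha>)) * 
        ennreal (abel_poisson \<alpha> p t s * (s - \<sigma>) powr (\<alpha> - 1) * indicator {\<sigma>..p} s)"
    proof eventually_elim
      case (elim s)
      show ?case
      proof (cases "s \<in> {\<sigma>..p}")
        case True
        then have P: "0 \<le> abel_poisson \<alpha> p t s"
          using assms by (intro abel_poisson_nonneg) auto
        have "1 = (s - \<sigma>) powr (1 - \<alpha>) * (s - \<sigma>) powr (\<alpha> - 1)"
          using True elim assms by (simp add: powr_add[symmetric])
        also have "\<dots> \<le> (t - \<sigma>) powr (1 - \<alpha>) * (s - \<sigma>) powr (\<alpha> - 1)"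
          using True assms by (intro mult_right_mono powr_mono2) auto
        finally have "abel_poisson \<alpha> p t s * 1 \<le>
            abel_poisson \<alpha> p t s * ((t - \<sigma>) powr (1 - \<alpha>) * (s - \<sigma>) powr (\<alpha> - 1))"
          using P by (rule mult_left_mono)
        then show ?thesis using True P by (simp add: ennreal_mult[symmetric] mult_ac)
      qed simp
    qed
  qed
  also have "\<dots> = ennreal ((t - \<sigma>) powr (1 - \<alpha>)) * ennreal ((t - \<sigma>) powr (\<alpha> - 1))"
    by (subst nn_integral_cmult) (use nn_integral_abel_poisson[OF assms] in auto)
  also have "\<dots> = 1"
    using assms by (simp add: ennreal_mult[symmetric] powr_add[symmetric])
  finally show ?thesis .
qed

lemma integral_convolution_swap:
  fixes A k v C :: "real \<Rightarrow> real"
  assumes [measurable]: "A \<in> borel_measurable borel" "k \<in> borel_measurable borel"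
    and A: "\<And>s. s \<in> {0..p} \<Longrightarrow> 0 \<le> A s" and k: "\<And>x. 0 \<le> k x"
    and v: "continuous_on {0..p} v" and C: "continuous_on {0..p} C"
    and AkC: "\<And>\<sigma>. \<sigma> \<in> {0..<p} \<Longrightarrow> 
      (\<integral>\<^sup>+s. ennreal (A s * k (s - \<sigma>) * indicator {\<sigma>..p} s) \<partial>lborel) = ennreal (C \<sigma>)"
    and C0: "\<And>\<sigma>. \<sigma> \<in> {0..<p} \<Longrightarrow> 0 \<le> C \<sigma>"
  shows "(LINT s:{0..p}|lborel. A s * (LINT \<sigma>:{0..s}|lborel. k (s - \<sigma>) * v \<sigma>))
    = (LINT \<sigma>:{0..p}|lborel. C \<sigma> * v \<sigma>)"
proof -
  define v' where "v' = (\<lambda>\<sigma>. indicator {0..p} \<sigma> *\<^sub>R v \<sigma>)"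
  have [measurable]: "v' \<in> borel_measurable borel"
    unfolding v'_def using v by (intro borel_measurable_continuous_on_indicator) auto
  define G where "G = (\<lambda>s \<sigma>. (if 0 \<le> \<sigma> \<and> \<sigma> \<le> s \<and> s \<le> p then A s * k (s - \<sigma>) else 0) * v' \<sigma>)"
  have [measurable]: "case_prod G \<in> borel_measurable (lborel \<Otimes>\<^sub>M lborel)"
    unfolding G_def by measurable
  have ae: "AE \<sigma> in lborel. \<sigma> \<noteq> p" by (rule AE_lborel_singleton)
  have nG: "(\<integral>\<^sup>+s. ennreal (norm (G s \<sigma>)) \<partial>lborel) = ennreal (indicator {0..p} \<sigma> * (C \<sigma> * \<bar>v \<sigma>\<bar>))"
    if "\<sigma> \<noteq> p" for \<sigma>
  proof (cases "\<sigma> \<in> {0..<p}")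
    case True
    have "(\<integral>\<^sup>+s. ennreal (norm (G s \<sigma>)) \<partial>lborel)
      = (\<integral>\<^sup>+s. ennreal \<bar>v \<sigma>\<bar> * ennreal (A s * k (s - \<sigma>) * indicator {\<sigma>..p} s) \<partial>lborel)"
      using True A k 
      by (intro nn_integral_cong)
         (auto simp: G_def v'_def abs_mult ennreal_mult[symmetric] mult_ac split: split_indicator)
    also have "\<dots> = ennreal \<bar>v \<sigma>\<bar> * ennreal (C \<sigma>)"
      by (subst nn_integral_cmult) (use AkC[OF True] in auto)
    finally show ?thesis using True C0[OF True] by (simp add: ennreal_mult[symmetric] mult.commute)
  next
    case False
    then have "\<sigma> \<notin> {0..p}" using that by auto
    then have "G s \<sigma> = 0" for s by (auto simp: G_def)
    then show ?thesis using \<open>\<sigma> \<notin> {0..p}\<close> by simp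
  qed
  have int_bd: "set_integrable lborel {0..p} (\<lambda>\<sigma>. C \<sigma> * \<bar>v \<sigma>\<bar>)"
    using v C by (intro borel_integrable_atLeastAtMost' continuous_intros)
  have "integrable (lborel \<Otimes>\<^sub>M lborel) (case_prod G)"
  proof (rule integrableI_bounded)
    have "(\<integral>\<^sup>+x. ennreal (norm (case_prod G x)) \<partial>(lborel \<Otimes>\<^sub>M lborel)) =
        (\<integral>\<^sup>+\<sigma>. (\<integral>\<^sup>+s. ennreal (norm (G s \<sigma>)) \<partial>lborel) \<partial>lborel)"
      by (subst lborel.nn_integral_fst[symmetric], simp, subst lborel_pair.Fubini') auto
    also have "\<dots> = (\<integral>\<^sup>+\<sigma>. ennreal (indicator {0..p} \<sigma> * (C \<sigma> * \<bar>v \<sigma>\<bar>)) \<partial>lborel)"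
      by (intro nn_integral_cong_AE eventually_mono[OF ae] nG)
    also have "\<dots> \<le> (\<integral>\<^sup>+\<sigma>. ennreal (norm (indicator {0..p} \<sigma> *\<^sub>R (C \<sigma> * \<bar>v \<sigma>\<bar>))) \<partial>lborel)"
      by (intro nn_integral_mono ennreal_leI) (auto split: split_indicator)
    also have "\<dots> < \<infinity>"
      using int_bd unfolding set_integrable_def integrable_iff_bounded by simp
    finally show "(\<integral>\<^sup>+x. ennreal (norm (case_prod G x)) \<partial>(lborel \<Otimes>\<^sub>M lborel)) < \<infinity>" .
  qed simp
  then have swap: "(LINT \<sigma>|lborel. LINT s|lborel. G s \<sigma>) = (LINT s|lborel. LINT \<sigma>|lborel. G s \<sigma>)"
    by (rule lborel_pair.Fubini_integral)
  have "(LINT s|lborel. LINT \<sigma>|lborel. G s \<sigma>) =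
      (LINT s:{0..p}|lborel. A s * (LINT \<sigma>:{0..s}|lborel. k (s - \<sigma>) * v \<sigma>))"
    unfolding set_lebesgue_integral_def
  proof (intro Bochner_Integration.integral_cong refl, goal_cases)
    case (1 s)
    show ?case
    proof (cases "s \<in> {0..p}")
      case True
      have "(LINT \<sigma>|lborel. G s \<sigma>) = (LINT \<sigma>|lborel. A s * (indicator {0..s} \<sigma> * (k (s - \<sigma>) * v \<sigma>)))"
        using True by (intro Bochner_Integration.integral_cong) (auto simp: G_def v'_def split: split_indicator)
      then show ?thesis using True by simp
    next
      case False
      then have "G s = (\<lambda>\<sigma>. 0)" by (auto simp: G_def)
      then show ?thesis using False by simp
    qed
  qed
  moreover have "(LINT \<sigma>|lborel. LINT s|lborel. G s \<sigma>) = (LINT \<sigma>:{0..p}|lborel. C \<sigma> * v \<sigma>)"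
    unfolding set_lebesgue_integral_def
  proof (intro integral_cong_AE)
    show "AE \<sigma> in lborel. (LINT s|lborel. G s \<sigma>) = indicator {0..p} \<sigma> *\<^sub>R (C \<sigma> * v \<sigma>)"
      using ae
    proof eventually_elim
      case (elim \<sigma>)
      show ?case
      proof (cases "\<sigma> \<in> {0..<p}")
        case True
        have "(LINT s|lborel. G s \<sigma>) = (LINT s|lborel. v \<sigma> * (A s * k (s - \<sigma>) * indicator {\<sigma>..p} s))"
          using True by (intro Bochner_Integration.integral_cong) (auto simp: G_def v'_def split: split_indicator)
        also have "\<dots> = v \<sigma> * (LINT s|lborel. A s * k (s - \<sigma>) * indicator {\<sigma>..p} s)" by simp
        also have "(LINT s|lborel. A s * k (s - \<sigma>) * indicator {\<sigma>..p} s) = C \<sigma>"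
          by (subst integral_eq_nn_integral)
             (use A k True C0[OF True] AkC[OF True] in \<open>auto split: split_indicator\<close>)
        finally show ?thesis using True by simp
      next
        case False
        then have "\<sigma> \<notin> {0..p}" using elim by auto
        then have "G s \<sigma> = 0" for s by (auto simp: G_def)
        then show ?thesis using \<open>\<sigma> \<notin> {0..p}\<close> by simp
      qed
    qed
    have "continuous_on {0..p} (\<lambda>\<sigma>. C \<sigma> * v \<sigma>)" using v C by (intro continuous_intros)
    then show "(\<lambda>\<sigma>. indicator {0..p} \<sigma> *\<^sub>R (C \<sigma> * v \<sigma>)) \<in> borel_measurable lborel"
      using borel_measurable_continuous_on_indicator[of "{0..p}" "\<lambda>\<sigma>. C \<sigma> * v \<sigma>"] by simp
  qed measurable
  ultimately show ?thesis using swap by simp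
qed

section \<open>Convolutions and fractional integrals\<close>

lemma continuous_on_Icc_bounded:
  fixes v :: "real \<Rightarrow> real"
  assumes "continuous_on {a..b} v"
  shows "\<exists>B. \<forall>s\<in>{a..b}. \<bar>v s\<bar> \<le> B"
  using compact_imp_bounded[OF compact_continuous_image[OF assms compact_Icc]] unfolding bounded_iff by auto

lemma set_integrable_powr:
  fixes \<beta> T :: real
  assumes "0 < \<beta>"
  shows "set_integrable lborel {0..T} (\<lambda>s. s powr (\<beta> - 1))"
proof -
  have "(\<lambda>s. s powr (\<beta> - 1)) absolutely_integrable_on {0..T}"
  proof (cases "T \<ge> 0")
    case True
    have "(\<lambda>s. s powr (\<beta> - 1)) integrable_on {0..T}"
      using has_integral_powr_from_0[of "\<beta> - 1" T] True assms by auto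
    then show ?thesis by (intro nonnegative_absolutely_integrable_1) auto
  qed auto
  then show ?thesis
    unfolding set_integrable_def by (subst (asm) integrable_completion) auto
qed

lemma set_integrable_convolution:
  fixes \<kappa> v :: "real \<Rightarrow> real"
  assumes [measurable]: "\<kappa> \<in> borel_measurable borel" and \<kappa>: "set_integrable lborel {0..T} \<kappa>"
    and v: "continuous_on {0..T} v" and t: "t \<in> {0..T}"
  shows "set_integrable lborel {0..t} (\<lambda>s. \<kappa> (t - s) * v s)"
proof -
  obtain B where B: "\<And>s. s \<in> {0..T} \<Longrightarrow> \<bar>v s\<bar> \<le> B"
    using continuous_on_Icc_bounded[OF v] by blast
  have "0 \<le> B" using B[OF t] by linarith
  have "integrable lborel (\<lambda>s. indicator {0..T} s *\<^sub>R \<kappa> s)" using \<kappa> unfolding set_integrable_def .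
  from lborel_integrable_real_affine[OF this, of "-1" t]
  have "integrable lborel (\<lambda>s. B * (indicator {0..T} (t - s) *\<^sub>R \<kappa> (t - s)))" by auto
  then have "integrable lborel (\<lambda>s. indicator {0..t} s *\<^sub>R (\<kappa> (t - s) * (indicator {0..T} s *\<^sub>R v s)))"
  proof (rule Bochner_Integration.integrable_bound)
    have [measurable]: "(\<lambda>s. indicator {0..T} s *\<^sub>R v s) \<in> borel_measurable borel"
      using v by (intro borel_measurable_continuous_on_indicator) auto
    show "(\<lambda>s. indicator {0..t} s *\<^sub>R (\<kappa> (t - s) * (indicator {0..T} s *\<^sub>R v s))) \<in> borel_measurable lborel"
      by measurable
    show "AE s in lborel. norm (indicator {0..t} s *\<^sub>R (\<kappa> (t - s) * (indicator {0..T} s *\<^sub>R v s)))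
      \<le> norm (B * (indicator {0..T} (t - s) *\<^sub>R \<kappa> (t - s)))"
      using B t \<open>0 \<le> B\<close> by (intro AE_I2) (auto simp: abs_mult mult.commute intro!: mult_right_mono split: split_indicator)
  qed
  moreover have "(\<lambda>s. indicator {0..t} s *\<^sub>R (\<kappa> (t - s) * (indicator {0..T} s *\<^sub>R v s)))
    = (\<lambda>s. indicator {0..t} s *\<^sub>R (\<kappa> (t - s) * v s))"
    using t by (auto simp: fun_eq_iff split: split_indicator)
  ultimately show ?thesis unfolding set_integrable_def by simp
qed

lemma convolution_reflect:
  fixes \<kappa> v :: "real \<Rightarrow> real"
  shows "(LINT s:{0..t}|lborel. \<kappa> (t - s) * v s) = (LINT s:{0..t}|lborel. \<kappa> s * v (t - s))"
  unfolding set_lebesgue_integral_def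
  by (subst lborel_integral_real_affine[where c = "-1" and t = t])
     (auto intro!: Bochner_Integration.integral_cong split: split_indicator)

lemma continuous_on_convolution:
  fixes \<kappa> v :: "real \<Rightarrow> real"
  assumes [measurable]: "\<kappa> \<in> borel_measurable borel" and \<kappa>: "set_integrable lborel {0..T} \<kappa>"
    and v: "continuous_on {0..T} v"
  shows "continuous_on {0..T} (\<lambda>t. LINT s:{0..t}|lborel. \<kappa> (t - s) * v s)"
  unfolding convolution_reflect continuous_on_sequentially
proof (intro ballI allI impI, elim conjE, unfold o_def set_lebesgue_integral_def)
  fix x :: "nat \<Rightarrow> real" and t assume t: "t \<in> {0..T}" and x: "\<forall>n. x n \<in> {0..T}" "x \<longlonglongrightarrow> t"
  obtain B where B: "\<And>s. s \<in> {0..T} \<Longrightarrow> \<bar>v s\<bar> \<le> B"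
    using continuous_on_Icc_bounded[OF v] by blast
  have "0 \<le> B" using B[OF t] by linarith
  have meas: "(\<lambda>s. indicator {0..r} s *\<^sub>R (\<kappa> s * v (r - s))) \<in> borel_measurable lborel" if "r \<in> {0..T}" for r
  proof -
    have [measurable]: "(\<lambda>s. indicator {0..r} s *\<^sub>R v (r - s)) \<in> borel_measurable borel"
      using that by (intro borel_measurable_continuous_on_indicator continuous_on_compose2[OF v] continuous_intros) auto
    have "(\<lambda>s. \<kappa> s * (indicator {0..r} s *\<^sub>R v (r - s))) \<in> borel_measurable lborel" by measurable
    then show ?thesis by (simp add: mult_ac)
  qed
  show "(\<lambda>n. LINT s|lborel. indicator {0..x n} s *\<^sub>R (\<kappa> s * v (x n - s)))
    \<longlonglongrightarrow> (LINT s|lborel. indicator {0..t} s *\<^sub>R (\<kappa> s * v (t - s)))"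
  proof (rule integral_dominated_convergence[where w = "\<lambda>s. B * \<bar>indicator {0..T} s *\<^sub>R \<kappa> s\<bar>"])
    show "integrable lborel (\<lambda>s. B * \<bar>indicator {0..T} s *\<^sub>R \<kappa> s\<bar>)"
      using \<kappa> unfolding set_integrable_def by (intro integrable_mult_right integrable_abs)
    show "AE s in lborel. norm (indicator {0..x n} s *\<^sub>R (\<kappa> s * v (x n - s))) \<le> B * \<bar>indicator {0..T} s *\<^sub>R \<kappa> s\<bar>" for n
    proof (intro AE_I2)
      fix s
      have "\<bar>\<kappa> s\<bar> * \<bar>v (x n - s)\<bar> \<le> \<bar>\<kappa> s\<bar> * B" if "s \<in> {0..x n}"
        using that x(1)[rule_format, of n] by (intro mult_left_mono B) auto
      then show "norm (indicator {0..x n} s *\<^sub>R (\<kappa> s * v (x n - s))) \<le> B * \<bar>indicator {0..T} s *\<^sub>R \<kappa> s\<bar>"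
        using x(1)[rule_format, of n] \<open>0 \<le> B\<close> by (auto simp: abs_mult mult.commute split: split_indicator)
    qed
    have "AE s in lborel. s \<noteq> t" by (rule AE_lborel_singleton)
    then show "AE s in lborel. (\<lambda>n. indicator {0..x n} s *\<^sub>R (\<kappa> s * v (x n - s)))
        \<longlonglongrightarrow> indicator {0..t} s *\<^sub>R (\<kappa> s * v (t - s))"
    proof eventually_elim
      case (elim s)
      show ?case
      proof (cases "0 \<le> s \<and> s < t")
        case True
        then have ev: "\<forall>\<^sub>F n in sequentially. s < x n" using x(2) order_tendstoD(1) by blast
        have "(\<lambda>n. v (x n - s)) \<longlonglongrightarrow> v (t - s)"
        proof (rule continuous_on_tendsto_compose[OF v])
          show "(\<lambda>n. x n - s) \<longlonglongrightarrow> t - s" using x(2) by (intro tendsto_intros)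
          show "t - s \<in> {0..T}" using True t by auto
          show "\<forall>\<^sub>F n in sequentially. x n - s \<in> {0..T}"
            using ev
          proof eventually_elim
            case (elim n)
            then show ?case using True x(1)[rule_format, of n] by auto
          qed
        qed
        then have "(\<lambda>n. \<kappa> s * v (x n - s)) \<longlonglongrightarrow> \<kappa> s * v (t - s)" by (intro tendsto_intros)
        then show ?thesis
          using True by (rule_tac Lim_transform_eventually) (use ev in \<open>auto elim!: eventually_mono\<close>)
      next
        case False
        then have "s < 0 \<or> t < s" using elim by auto
        then have "\<forall>\<^sub>F n in sequentially. s \<notin> {0..x n}"
          using order_tendstoD(2)[OF x(2), of s] by (auto elim!: eventually_mono)
        then have "\<forall>\<^sub>F n in sequentially. indicator {0..x n} s *\<^sub>R (\<kappa> s * v (x n - s)) = 0"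
          by eventually_elim simp
        moreover have "indicator {0..t} s *\<^sub>R (\<kappa> s * v (t - s)) = 0" using False elim by auto
        ultimately show ?thesis by (simp only: tendsto_eventually)
      qed
    qed
  qed (use meas t x in auto)
qed

lemma frac_int_altdef:
  "frac_int \<beta> v t = (LINT s:{0..t}|lborel. (\<lambda>x. 1 / Gamma \<beta> * x powr (\<beta> - 1)) (t - s) * v s)"
  by (simp add: frac_int_def mult.assoc)

lemma continuous_on_frac_int:
  assumes "0 < \<beta>" "continuous_on {0..T} v"
  shows "continuous_on {0..T} (frac_int \<beta> v)"
  unfolding frac_int_def using assms
  by (intro continuous_intros continuous_on_convolution set_integrable_powr) auto

lemma frac_int_0 [simp]: "frac_int \<beta> v 0 = 0"
proof -
  have "AE s in lborel. s \<noteq> (0::real)" by (rule AE_lborel_singleton)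
  then have "(LINT s:{0..0}|lborel. (0 - s) powr (\<beta> - 1) * v s) = 0"
    unfolding set_lebesgue_integral_def by (intro integral_eq_zero_AE) (auto elim!: eventually_mono)
  then show ?thesis by (simp add: frac_int_def)
qed

lemma frac_int_cong:
  assumes "\<And>s. s \<in> {0..t} \<Longrightarrow> v s = w s"
  shows "frac_int \<beta> v t = frac_int \<beta> w t"
  unfolding frac_int_def using assms by (auto intro!: set_lebesgue_integral_cong)

lemma frac_int_diff:
  assumes "0 < \<beta>" "continuous_on {0..T} v" "continuous_on {0..T} w" "t \<in> {0..T}"
  shows "frac_int \<beta> (\<lambda>s. v s - w s) t = frac_int \<beta> v t - frac_int \<beta> w t"
  unfolding frac_int_def right_diff_distrib
  using assms by (subst set_integral_diff)
    (auto intro!: set_integrable_convolution set_integrable_powr simp: right_diff_distrib)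

lemma frac_int_complement:
  assumes "0 < \<alpha>" "\<alpha> < 1" and v: "continuous_on {0..T} v" and t: "t \<in> {0..T}"
  shows "frac_int (1 - \<alpha>) (frac_int \<alpha> v) t = integral {0..t} v"
proof -
  let ?G = "Gamma \<alpha> * Gamma (1 - \<alpha>)"
  have G: "Gamma \<alpha> > 0" "Gamma (1 - \<alpha>) > 0" using assms by (auto simp: Gamma_real_pos)
  have v': "continuous_on {0..t} v" using v t by (auto intro: continuous_on_subset)
  have "(LINT s:{0..t}|lborel. (t - s) powr (-\<alpha>) * (LINT \<sigma>:{0..s}|lborel. (s - \<sigma>) powr (\<alpha> - 1) * v \<sigma>))
    = (LINT \<sigma>:{0..t}|lborel. ?G * v \<sigma>)"
    using assms v' G
    by (intro integral_convolution_swap) (auto intro!: nn_integral_abel_semigroup less_imp_le)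
  also have "\<dots> = ?G * integral {0..t} v"
    using set_borel_integral_eq_integral(2)[OF borel_integrable_atLeastAtMost'[OF v']] by simp
  finally show ?thesis
    using G by (simp add: frac_int_def)
qed


section \<open>Positivity\<close>

lemma frac_volterra_pos:
  assumes \<alpha>: "0 < \<alpha>" "\<alpha> < 1" and "0 < b"
    and w: "continuous_on {0..T} w" and h: "continuous_on {0..T} h"
    and eq: "\<And>t. t \<in> {0..T} \<Longrightarrow> w t = b + frac_int \<alpha> h t"
    and zero: "\<And>t. t \<in> {0..T} \<Longrightarrow> w t = 0 \<Longrightarrow> 0 < h t"
    and t: "t \<in> {0..T}"
  shows "0 < w t"
proof (rule ccontr)
  \<comment> \<open>At the first zero \<open>t1\<close> of \<open>w\<close>, \<open>h\<close> is positive on some \<open>[p,t1]\<close>, and dropping this part of the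
    integral only decreases \<open>w t1\<close>; what remains is an average of \<open>w \<ge> 0\<close> over \<open>[0,p]\<close> plus a
    nonnegative multiple of \<open>b\<close>.\<close>
  assume "\<not> 0 < w t"
  have G: "Gamma \<alpha> > 0" using \<alpha> by (simp add: Gamma_real_pos)
  define Z where "Z = {s \<in> {0..T}. w s \<le> 0}"
  have "closed Z" unfolding Z_def
    using w by (intro continuous_on_closed_Collect_le continuous_intros) auto
  moreover have "Z \<noteq> {}" "bdd_below Z" using t \<open>\<not> 0 < w t\<close> by (auto simp: Z_def)
  ultimately have "Inf Z \<in> Z" by (intro closed_contains_Inf)
  define t1 where "t1 = Inf Z"
  have t1: "t1 \<in> {0..T}" "w t1 \<le> 0" using \<open>Inf Z \<in> Z\<close> by (auto simp: Z_def t1_def)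
  have before: "0 < w s" if "s \<in> {0..<t1}" for s
  proof (rule ccontr)
    assume "\<not> 0 < w s"
    then have "s \<in> Z" using that t1 by (auto simp: Z_def)
    then have "t1 \<le> s" unfolding t1_def using \<open>bdd_below Z\<close> by (rule cInf_lower)
    then show False using that by simp
  qed
  have "w 0 = b" using eq[of 0] t by auto
  then have "0 < t1" using t1 \<open>0 < b\<close> by (cases "t1 = 0") auto
  obtain r where r: "r \<in> {0..t1}" "w r = 0"
    using IVT2'[of w t1 0 0] t1 \<open>w 0 = b\<close> \<open>0 < b\<close> \<open>0 < t1\<close> continuous_on_subset[OF w, of "{0..t1}"] by auto
  then have "r = t1" using before[of r] by (cases "r = t1") auto
  with r have "w t1 = 0" by simp
  with zero t1 have "0 < h t1" by simp
  obtain d where d: "0 < d" "\<And>s. s \<in> {0..T} \<Longrightarrow> \<bar>s - t1\<bar> < d \<Longrightarrow> \<bar>h s - h t1\<bar> < h t1 / 2"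
    using h[unfolded continuous_on_iff, rule_format, OF t1(1), of "h t1 / 2"] \<open>0 < h t1\<close>
    by (auto simp: dist_real_def)
  define p where "p = max (t1 / 2) (t1 - d / 2)"
  have p: "0 < p" "p < t1" using \<open>0 < t1\<close> \<open>0 < d\<close> by (auto simp: p_def)
  have hp: "h t1 / 2 \<le> h s" if "s \<in> {p..t1}" for s
  proof -
    have "s \<in> {0..T}" "\<bar>s - t1\<bar> < d" using that t1 p d(1) by (auto simp: p_def)
    then show ?thesis using d(2)[of s] by linarith
  qed
  let ?k = "\<lambda>s. (t1 - s) powr (\<alpha> - 1) * h s"
  have int: "set_integrable lborel {0..t1} ?k"
    using \<alpha> h t1 by (intro set_integrable_convolution set_integrable_powr) auto
  have "(LINT s:{0..t1}|lborel. ?k s) = (LINT s:{0..p}|lborel. ?k s) + (LINT s:{p<..t1}|lborel. ?k s)"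
  proof -
    have "{0..t1} = {0..p} \<union> {p<..t1}" using p by auto
    moreover have "set_integrable lborel {0..p} ?k" "set_integrable lborel {p<..t1} ?k"
      by (rule set_integrable_subset[OF int]; use p in auto)+
    moreover have "{0..p} \<inter> {p<..t1} = {}" by auto
    ultimately show ?thesis by (simp only: set_integral_Un)
  qed
  moreover have "0 < (LINT s:{p<..t1}|lborel. ?k s)"
  proof -
    let ?c = "(t1 - p) powr (\<alpha> - 1) * (h t1 / 2)"
    have "(LINT s:{p<..<t1}|lborel. ?c) \<le> (LINT s:{p<..<t1}|lborel. ?k s)"
    proof (rule set_integral_mono)
      show "set_integrable lborel {p<..<t1} ?k" by (rule set_integrable_subset[OF int]) (use p in auto)
      show "?c \<le> ?k s" if "s \<in> {p<..<t1}" for s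
      proof (rule mult_mono)
        show "(t1 - p) powr (\<alpha> - 1) \<le> (t1 - s) powr (\<alpha> - 1)"
          using that \<alpha> by (intro powr_mono2') auto
        show "h t1 / 2 \<le> h s" using hp that by simp
      qed (use \<open>0 < h t1\<close> in auto)
      show "set_integrable lborel {p<..<t1} (\<lambda>s. ?c)"
        by (rule set_integrable_subset[OF borel_integrable_atLeastAtMost'[of p t1]]) auto
    qed
    moreover have "0 < (LINT s:{p<..<t1}|lborel. ?c)"
      using p \<open>0 < h t1\<close> by (simp add: set_lebesgue_integral_def)
    moreover have "(LINT s:{p<..<t1}|lborel. ?k s) = (LINT s:{p<..t1}|lborel. ?k s)"
      unfolding set_lebesgue_integral_def using p
      by (intro Bochner_Integration.integral_cong) (auto split: split_indicator)
    ultimately show ?thesis by simp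
  qed
  moreover have "- (Gamma \<alpha> * b) \<le> (LINT s:{0..p}|lborel. ?k s)"
  proof -
    let ?A = "abel_poisson \<alpha> p t1"
    have A0: "0 \<le> ?A s" if "s \<in> {0..p}" for s
      using that p \<alpha> by (intro abel_poisson_nonneg) auto
    have hp: "continuous_on {0..p} h" using h t1 p by (auto intro: continuous_on_subset)
    have "(LINT s:{0..p}|lborel. ?A s * (LINT \<sigma>:{0..s}|lborel. (s - \<sigma>) powr (\<alpha> - 1) * h \<sigma>))
      = (LINT s:{0..p}|lborel. ?k s)"
      using \<alpha> p hp A0
      by (intro integral_convolution_swap)
         (auto intro!: nn_integral_abel_poisson continuous_intros)
    moreover have "(LINT s:{0..p}|lborel. ?A s * (LINT \<sigma>:{0..s}|lborel. (s - \<sigma>) powr (\<alpha> - 1) * h \<sigma>))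
      = (LINT s:{0..p}|lborel. - Gamma \<alpha> * (?A s * (b - w s)))"
    proof (intro set_lebesgue_integral_cong allI impI)
      fix s assume "s \<in> {0..p}"
      then have "(LINT \<sigma>:{0..s}|lborel. (s - \<sigma>) powr (\<alpha> - 1) * h \<sigma>) = - Gamma \<alpha> * (b - w s)"
        using eq[of s] p t1 G by (simp add: frac_int_def)
      then show "?A s * (LINT \<sigma>:{0..s}|lborel. (s - \<sigma>) powr (\<alpha> - 1) * h \<sigma>) = - Gamma \<alpha> * (?A s * (b - w s))"
        by (simp only: mult.left_commute)
    qed auto
    ultimately have k: "(LINT s:{0..p}|lborel. ?k s) = - Gamma \<alpha> * (LINT s:{0..p}|lborel. ?A s * (b - w s))"
      by (simp only: set_integral_mult_right)
    have nn: "(\<integral>\<^sup>+s. ennreal (indicator {0..p} s *\<^sub>R ?A s) \<partial>lborel) \<le> 1"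
      using nn_integral_abel_poisson_le_1[OF \<alpha> p] by (simp add: mult.commute)
    have intA: "integrable lborel (\<lambda>s. indicator {0..p} s *\<^sub>R ?A s)"
      using nn by (intro integrableI_nonneg)
        (auto split: split_indicator simp: A0 intro: order.strict_trans1)
    have "ennreal (LINT s:{0..p}|lborel. ?A s) \<le> 1"
      using nn intA unfolding set_lebesgue_integral_def
      by (subst nn_integral_eq_integral[symmetric]) (auto split: split_indicator simp: A0)
    then have le1: "(LINT s:{0..p}|lborel. ?A s) \<le> 1" by simp
    have "(LINT s:{0..p}|lborel. ?A s * (b - w s)) \<le> (LINT s:{0..p}|lborel. b * ?A s)"
      unfolding set_lebesgue_integral_def
    proof (rule integral_mono')
      show "integrable lborel (\<lambda>s. indicator {0..p} s *\<^sub>R (b * ?A s))"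
        using integrable_mult_right[OF intA, of b] by (simp add: mult_ac)
      show "indicator {0..p} s *\<^sub>R (?A s * (b - w s)) \<le> indicator {0..p} s *\<^sub>R (b * ?A s)" for s
        using A0[of s] before[of s] p by (auto split: split_indicator simp: algebra_simps)
      show "0 \<le> indicator {0..p} s *\<^sub>R (b * ?A s)" for s
        using A0[of s] \<open>0 < b\<close> by (auto split: split_indicator)
    qed
    also have "\<dots> \<le> b" using le1 \<open>0 < b\<close> by simp
    finally show ?thesis unfolding k using G by simp
  qed
  ultimately have "- (Gamma \<alpha> * b) < (LINT s:{0..t1}|lborel. ?k s)" by simp
  then have "- b < frac_int \<alpha> h t1"
    using G by (simp add: frac_int_def field_simps)
  then show False using eq[OF t1(1)] \<open>w t1 = 0\<close> by simp
qed

lemma frac_volterra_nonneg: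
  assumes \<alpha>: "0 < \<alpha>" "\<alpha> < 1" and "0 \<le> b"
    and w: "continuous_on {0..T} w" and h: "continuous_on {0..T} h"
    and eq: "\<And>t. t \<in> {0..T} \<Longrightarrow> w t = b + frac_int \<alpha> h t"
    and neg: "\<And>t. t \<in> {0..T} \<Longrightarrow> w t < 0 \<Longrightarrow> 0 < h t"
    and t: "t \<in> {0..T}"
  shows "0 \<le> w t"
proof (rule field_le_epsilon)
  fix e :: real assume "0 < e"
  have "0 < w t + e"
    using assms \<open>0 < e\<close> by (intro frac_volterra_pos[where w = "\<lambda>t. w t + e" and b = "b + e" and h = h])
      (auto intro!: continuous_intros)
  then show "0 \<le> w t + e" by simp
qed


section \<open>Linear Volterra equations and the fractional equation\<close>

lemma convolution_bound:
  fixes \<kappa> v :: "real \<Rightarrow> real"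
  assumes [measurable]: "\<kappa> \<in> borel_measurable borel" and \<kappa>: "set_integrable lborel {0..T} \<kappa>"
    and \<kappa>0: "\<And>s. 0 \<le> \<kappa> s"
    and v: "continuous_on {0..T} v" and B: "\<And>s. s \<in> {0..T} \<Longrightarrow> \<bar>v s\<bar> \<le> B" and t: "t \<in> {0..T}"
  shows "\<bar>LINT s:{0..t}|lborel. \<kappa> (t - s) * v s\<bar> \<le> B * (LINT s:{0..T}|lborel. \<kappa> s)"
proof -
  have "0 \<le> B" using B[OF t] by linarith
  have I: "set_integrable lborel {0..t} (\<lambda>s. \<kappa> (t - s) * v s)"
    using assms by (intro set_integrable_convolution)
  have \<kappa>t: "set_integrable lborel {0..t} \<kappa>" by (rule set_integrable_subset[OF \<kappa>]) (use t in auto)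
  have "\<bar>LINT s:{0..t}|lborel. \<kappa> (t - s) * v s\<bar> \<le> (LINT s:{0..t}|lborel. \<bar>\<kappa> (t - s) * v s\<bar>)"
    using set_integral_norm_bound[OF I] by simp
  also have "\<dots> \<le> (LINT s:{0..t}|lborel. \<kappa> (t - s) * B)"
  proof (rule set_integral_mono)
    show "set_integrable lborel {0..t} (\<lambda>s. \<bar>\<kappa> (t - s) * v s\<bar>)"
      using I by (rule set_integrable_abs)
    show "set_integrable lborel {0..t} (\<lambda>s. \<kappa> (t - s) * B)"
      using assms by (intro set_integrable_convolution) auto
    show "\<bar>\<kappa> (t - s) * v s\<bar> \<le> \<kappa> (t - s) * B" if "s \<in> {0..t}" for s
      using B[of s] \<kappa>0 that t by (auto simp: abs_mult intro!: mult_left_mono)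
  qed
  also have "\<dots> = B * (LINT s:{0..t}|lborel. \<kappa> s)"
    unfolding convolution_reflect[of t \<kappa> "\<lambda>_. B"] by (simp add: mult.commute)
  also have "\<dots> \<le> B * (LINT s:{0..T}|lborel. \<kappa> s)"
  proof (rule mult_left_mono[OF _ \<open>0 \<le> B\<close>])
    show "(LINT s:{0..t}|lborel. \<kappa> s) \<le> (LINT s:{0..T}|lborel. \<kappa> s)"
      unfolding set_lebesgue_integral_def
    proof (rule integral_mono)
      show "indicator {0..t} s *\<^sub>R \<kappa> s \<le> indicator {0..T} s *\<^sub>R \<kappa> s" for s
        using t \<kappa>0 by (auto split: split_indicator)
    qed (use \<kappa> \<kappa>t in \<open>auto simp: set_integrable_def\<close>)
  qed
  finally show ?thesis .
qed

lemma exp_damped_integral_tendsto_0: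
  fixes \<kappa> :: "real \<Rightarrow> real"
  assumes [measurable]: "\<kappa> \<in> borel_measurable borel" and \<kappa>: "set_integrable lborel {0..T} \<kappa>"
  shows "(\<lambda>n. LINT s:{0..T}|lborel. exp (- real n * s) * \<kappa> s) \<longlonglongrightarrow> 0"
proof -
  have "(\<lambda>n. LINT s|lborel. indicator {0..T} s *\<^sub>R (exp (- real n * s) * \<kappa> s)) \<longlonglongrightarrow> (LINT s|(lborel :: real measure). 0)"
  proof (rule integral_dominated_convergence)
    show "integrable lborel (\<lambda>s. \<bar>indicator {0..T} s *\<^sub>R \<kappa> s\<bar>)"
      using \<kappa> unfolding set_integrable_def by (rule integrable_abs)
    show "AE s in lborel. norm (indicator {0..T} s *\<^sub>R (exp (- real n * s) * \<kappa> s)) \<le> \<bar>indicator {0..T} s *\<^sub>R \<kappa> s\<bar>" for n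
      by (intro AE_I2) (auto simp: abs_mult mult_left_le_one_le split: split_indicator)
    have "AE s in lborel. s \<noteq> (0 :: real)" by (rule AE_lborel_singleton)
    then show "AE s in lborel. (\<lambda>n. indicator {0..T} s *\<^sub>R (exp (- real n * s) * \<kappa> s)) \<longlonglongrightarrow> 0"
    proof eventually_elim
      case (elim s)
      show ?case
      proof (cases "s \<in> {0..T}")
        case True
        then have "0 < s" using elim by simp
        have "(\<lambda>n. exp (- s) ^ n) \<longlonglongrightarrow> 0"
          using \<open>0 < s\<close> by (intro LIMSEQ_power_zero) auto
        then have "(\<lambda>n. exp (- real n * s)) \<longlonglongrightarrow> 0"
          by (simp add: exp_of_nat_mult[symmetric])
        then have "(\<lambda>n. exp (- real n * s) * \<kappa> s) \<longlonglongrightarrow> 0" by (rule tendsto_mult_left_zero)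
        then show ?thesis using True by simp
      qed simp
    qed
  qed measurable
  then show ?thesis by (simp add: set_lebesgue_integral_def)
qed

lemma volterra_exists:
  fixes \<kappa> q p :: "real \<Rightarrow> real"
  assumes "0 \<le> T" and [measurable]: "\<kappa> \<in> borel_measurable borel" and \<kappa>: "set_integrable lborel {0..T} \<kappa>"
    and \<kappa>0: "\<And>s. 0 \<le> \<kappa> s"
    and p: "continuous_on {0..T} p" and q: "continuous_on {0..T} q"
  shows "\<exists>v. continuous_on {0..T} v \<and>
    (\<forall>t\<in>{0..T}. v t = p t - (LINT s:{0..t}|lborel. \<kappa> (t - s) * (q s * v s)))"
proof -
  obtain Q where Q: "\<And>s. s \<in> {0..T} \<Longrightarrow> \<bar>q s\<bar> \<le> Q"
    using continuous_on_Icc_bounded[OF q] by blast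
  have "0 \<le> Q" using Q[of 0] \<open>0 \<le> T\<close> by auto
  \<comment> \<open>\<open>z t = exp (- n t) v t\<close> solves the equation with the damped kernel \<open>\<mu> n\<close>, for which the Picard
    map is a contraction once \<open>n\<close> is large\<close>
  define \<mu> where "\<mu> n s = exp (- real n * s) * \<kappa> s" for n s
  have \<mu>_meas [measurable]: "\<mu> n \<in> borel_measurable borel" for n unfolding \<mu>_def by measurable
  have \<mu>0: "0 \<le> \<mu> n s" for n s by (simp add: \<mu>_def \<kappa>0)
  have \<mu>: "set_integrable lborel {0..T} (\<mu> n)" for n
    unfolding set_integrable_def
  proof (rule Bochner_Integration.integrable_bound)
    show "integrable lborel (\<lambda>s. indicator {0..T} s *\<^sub>R \<kappa> s)" using \<kappa> unfolding set_integrable_def .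
    show "AE s in lborel. norm (indicator {0..T} s *\<^sub>R \<mu> n s) \<le> norm (indicator {0..T} s *\<^sub>R \<kappa> s)"
      by (intro AE_I2) (auto simp: \<mu>_def abs_mult mult_left_le_one_le split: split_indicator)
  qed measurable
  have "(\<lambda>n. Q * (LINT s:{0..T}|lborel. \<mu> n s)) \<longlonglongrightarrow> Q * 0"
    unfolding \<mu>_def by (intro tendsto_intros exp_damped_integral_tendsto_0 \<kappa>) auto
  then have "\<forall>\<^sub>F n in sequentially. Q * (LINT s:{0..T}|lborel. \<mu> n s) < 1/2"
    by (intro order_tendstoD) auto
  then obtain n where n: "Q * (LINT s:{0..T}|lborel. \<mu> n s) < 1/2" by (auto simp: eventually_sequentially)
  define \<Phi> where "\<Phi> z t = exp (- real n * t) * p t - (LINT s:{0..t}|lborel. \<mu> n (t - s) * (q s * z s))"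
    for z t
  have "\<exists>y. \<forall>x. apply_bcontfun y x = \<Phi> (apply_bcontfun z) (clamp 0 T x)" for z :: "real \<Rightarrow>\<^sub>C real"
  proof -
    have "continuous_on (cbox 0 T) (\<Phi> z)"
      unfolding \<Phi>_def cbox_interval using p q \<mu>
      by (intro continuous_intros continuous_on_convolution) auto
    then show ?thesis by (rule continuous_on_cbox_bcontfunE) blast
  qed
  then obtain \<Psi> :: "(real \<Rightarrow>\<^sub>C real) \<Rightarrow> (real \<Rightarrow>\<^sub>C real)"
    where \<Psi>: "\<And>z x. apply_bcontfun (\<Psi> z) x = \<Phi> (apply_bcontfun z) (clamp 0 T x)" by metis
  have "dist (\<Psi> z) (\<Psi> y) \<le> 1/2 * dist z y" for z y
  proof (rule dist_bound)
    fix x :: real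
    let ?t = "clamp 0 T x"
    have t: "?t \<in> {0..T}" using clamp_in_interval[of 0 T x] \<open>0 \<le> T\<close> by auto
    have I: "set_integrable lborel {0..?t} (\<lambda>s. \<mu> n (?t - s) * (q s * apply_bcontfun f s))" for f
      using \<mu> q t by (intro set_integrable_convolution continuous_intros) auto
    have "dist (apply_bcontfun (\<Psi> z) x) (apply_bcontfun (\<Psi> y) x)
      = \<bar>(LINT s:{0..?t}|lborel. \<mu> n (?t - s) * (q s * y s)) - (LINT s:{0..?t}|lborel. \<mu> n (?t - s) * (q s * z s))\<bar>"
      by (simp add: \<Psi> \<Phi>_def dist_real_def)
    also have "\<dots> = \<bar>LINT s:{0..?t}|lborel. \<mu> n (?t - s) * (q s * (y s - z s))\<bar>"
      by (subst set_integral_diff(2)[OF I I, symmetric]) (simp add: right_diff_distrib)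
    also have "\<dots> \<le> Q * dist z y * (LINT s:{0..T}|lborel. \<mu> n s)"
    proof (rule convolution_bound[OF \<mu>_meas \<mu> \<mu>0 _ _ t])
      show "\<bar>q s * (y s - z s)\<bar> \<le> Q * dist z y" if "s \<in> {0..T}" for s
        using Q[OF that] dist_bounded[of z s y] \<open>0 \<le> Q\<close>
        by (auto simp: abs_mult dist_real_def abs_minus_commute intro!: mult_mono)
    qed (auto intro!: continuous_intros q)
    also have "\<dots> \<le> 1/2 * dist z y"
      using mult_right_mono[OF less_imp_le[OF n], of "dist z y"] by (simp add: mult_ac)
    finally show "dist (apply_bcontfun (\<Psi> z) x) (apply_bcontfun (\<Psi> y) x) \<le> 1/2 * dist z y" .
  qed
  then obtain z where z: "\<Psi> z = z" using banach_fix_type[of "1/2" \<Psi>] by auto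
  define v where "v t = exp (real n * t) * z t" for t
  have "v t = p t - (LINT s:{0..t}|lborel. \<kappa> (t - s) * (q s * v s))" if t: "t \<in> {0..T}" for t
  proof -
    have "z t = \<Phi> z t" using \<Psi>[of z t] t by (simp add: z)
    then have "v t = exp (real n * t) * (exp (- real n * t) * p t)
        - exp (real n * t) * (LINT s:{0..t}|lborel. \<mu> n (t - s) * (q s * z s))"
      by (simp add: v_def \<Phi>_def right_diff_distrib)
    also have "exp (real n * t) * (exp (- real n * t) * p t) = p t"
      by (simp add: exp_minus)
    also have "exp (real n * t) * (LINT s:{0..t}|lborel. \<mu> n (t - s) * (q s * z s))
      = (LINT s:{0..t}|lborel. exp (real n * t) * (\<mu> n (t - s) * (q s * z s)))" by simp
    also have "\<dots> = (LINT s:{0..t}|lborel. \<kappa> (t - s) * (q s * v s))"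
    proof -
      have "exp (real n * t) * (\<mu> n (t - s) * (q s * z s)) = \<kappa> (t - s) * (q s * v s)" for s
      proof -
        have "exp (real n * t) * exp (- real n * (t - s)) = exp (real n * s)"
          by (simp add: exp_add[symmetric] algebra_simps)
        then show ?thesis by (simp add: \<mu>_def v_def mult_ac)
      qed
      then show ?thesis by (simp only:)
    qed
    finally show ?thesis .
  qed
  moreover have "continuous_on {0..T} v" unfolding v_def by (intro continuous_intros) auto
  ultimately show ?thesis by blast
qed

definition solves_frac_volterra ::
    "real \<Rightarrow> real \<Rightarrow> (real \<Rightarrow> real) \<Rightarrow> (real \<Rightarrow> real) \<Rightarrow> real \<Rightarrow> (real \<Rightarrow> real) \<Rightarrow> bool" where
  "solves_frac_volterra \<alpha> T q f b v \<longleftrightarrow> continuous_on {0..T} v \<and>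
     (\<forall>t\<in>{0..T}. v t = b + frac_int \<alpha> (\<lambda>s. f s - q s * v s) t)"

lemma solves_frac_volterra_exists:
  assumes \<alpha>: "0 < \<alpha>" and "0 \<le> T" and q: "continuous_on {0..T} q" and f: "continuous_on {0..T} f"
  shows "\<exists>v. solves_frac_volterra \<alpha> T q f b v"
proof -
  let ?\<kappa> = "\<lambda>x. 1 / Gamma \<alpha> * x powr (\<alpha> - 1)"
  have G: "Gamma \<alpha> > 0" using \<alpha> by (rule Gamma_real_pos)
  have "\<exists>v. continuous_on {0..T} v \<and>
    (\<forall>t\<in>{0..T}. v t = (b + frac_int \<alpha> f t) - (LINT s:{0..t}|lborel. ?\<kappa> (t - s) * (q s * v s)))"
    using assms G
    by (intro volterra_exists continuous_intros continuous_on_frac_int set_integrable_mult_right)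
       (auto intro!: set_integrable_powr)
  then obtain v where v: "continuous_on {0..T} v"
      "\<And>t. t \<in> {0..T} \<Longrightarrow> v t = (b + frac_int \<alpha> f t) - frac_int \<alpha> (\<lambda>s. q s * v s) t"
    unfolding frac_int_altdef[symmetric] by blast
  have "v t = b + frac_int \<alpha> (\<lambda>s. f s - q s * v s) t" if "t \<in> {0..T}" for t
    using v that q f \<alpha> by (subst frac_int_diff) (auto intro!: continuous_intros)
  with v(1) show ?thesis unfolding solves_frac_volterra_def by blast
qed

lemma solves_frac_volterra_cong:
  assumes "\<And>t. t \<in> {0..T} \<Longrightarrow> v t = w t"
  shows "solves_frac_volterra \<alpha> T q f b v \<longleftrightarrow> solves_frac_volterra \<alpha> T q f b w"
proof -
  have "frac_int \<alpha> (\<lambda>s. f s - q s * v s) t = frac_int \<alpha> (\<lambda>s. f s - q s * w s) t" if "t \<in> {0..T}" for t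
    using assms that by (intro frac_int_cong) auto
  moreover have "continuous_on {0..T} v \<longleftrightarrow> continuous_on {0..T} w"
    using assms by (intro continuous_on_cong) auto
  ultimately show ?thesis unfolding solves_frac_volterra_def using assms by auto
qed

lemma solves_frac_volterra_nonneg:
  assumes \<alpha>: "0 < \<alpha>" "\<alpha> < 1" and q: "continuous_on {0..T} q" "\<And>t. t \<in> {0..T} \<Longrightarrow> 0 < q t"
    and f: "continuous_on {0..T} f" "\<And>t. t \<in> {0..T} \<Longrightarrow> 0 \<le> f t" and "0 \<le> b"
    and v: "solves_frac_volterra \<alpha> T q f b v" and t: "t \<in> {0..T}"
  shows "0 \<le> v t"
proof (rule frac_volterra_nonneg[OF \<alpha> \<open>0 \<le> b\<close> _ _ _ _ t])
  show "v t = b + frac_int \<alpha> (\<lambda>s. f s - q s * v s) t" if "t \<in> {0..T}" for t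
    using v that unfolding solves_frac_volterra_def by blast
  show "0 < f t - q t * v t" if "t \<in> {0..T}" "v t < 0" for t
    using f(2)[of t] q(2)[of t] that mult_pos_neg[of "q t" "v t"] by linarith
qed (use v q f in \<open>auto simp: solves_frac_volterra_def intro!: continuous_intros\<close>)

lemma solves_frac_volterra_pos:
  assumes \<alpha>: "0 < \<alpha>" "\<alpha> < 1" and q: "continuous_on {0..T} q"
    and f: "continuous_on {0..T} f" "\<And>t. t \<in> {0..T} \<Longrightarrow> 0 < f t" and "0 < b"
    and v: "solves_frac_volterra \<alpha> T q f b v" and t: "t \<in> {0..T}"
  shows "0 < v t"
proof (rule frac_volterra_pos[OF \<alpha> \<open>0 < b\<close> _ _ _ _ t])
  show "v t = b + frac_int \<alpha> (\<lambda>s. f s - q s * v s) t" if "t \<in> {0..T}" for t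
    using v that unfolding solves_frac_volterra_def by blast
qed (use v q f in \<open>auto simp: solves_frac_volterra_def intro!: continuous_intros\<close>)

lemma solves_frac_volterra_antimono:
  assumes \<alpha>: "0 < \<alpha>" "\<alpha> < 1"
    and q1: "continuous_on {0..T} q1" "\<And>t. t \<in> {0..T} \<Longrightarrow> 0 < q1 t"
    and q2: "continuous_on {0..T} q2" and f: "continuous_on {0..T} f"
    and v1: "solves_frac_volterra \<alpha> T q1 f b v1" and v2: "solves_frac_volterra \<alpha> T q2 f b v2"
    and le: "\<And>t. t \<in> {0..T} \<Longrightarrow> q1 t * v2 t \<le> q2 t * v2 t"
    and t: "t \<in> {0..T}"
  shows "v2 t \<le> v1 t"
proof -
  have "0 \<le> v1 t - v2 t"
  proof (rule frac_volterra_nonneg[OF \<alpha> order_refl _ _ _ _ t])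
    let ?h = "\<lambda>s. (f s - q1 s * v1 s) - (f s - q2 s * v2 s)"
    show "v1 t - v2 t = 0 + frac_int \<alpha> ?h t" if "t \<in> {0..T}" for t
      using v1 v2 that \<alpha> q1 q2 f unfolding solves_frac_volterra_def
      by (subst frac_int_diff) (auto intro!: continuous_intros)
    show "0 < ?h t" if "t \<in> {0..T}" "v1 t - v2 t < 0" for t
      using mult_pos_neg[OF q1(2)[OF that(1)] that(2)] le[OF that(1)] by (simp add: algebra_simps)
  qed (use v1 v2 q1 q2 f in \<open>auto simp: solves_frac_volterra_def intro!: continuous_intros\<close>)
  then show ?thesis by simp
qed

lemma integral_zero_imp_zero:
  fixes z :: "real \<Rightarrow> real"
  assumes "0 < T" "continuous_on {0..T} z" "\<And>t. t \<in> {0..T} \<Longrightarrow> integral {0..t} z = 0" "t \<in> {0..T}"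
  shows "z t = 0"
proof -
  have "((\<lambda>x. integral {0..x} z) has_vector_derivative z t) (at t within {0..T})"
    using assms by (intro integral_has_vector_derivative)
  then have "((\<lambda>x. 0) has_vector_derivative z t) (at t within {0..T})"
    by (rule has_vector_derivative_transform[rotated 2]) (use assms in auto)
  then show ?thesis
    using vector_derivative_unique_within_closed_interval[of 0 T t "\<lambda>x. 0" "z t" 0] assms by auto
qed

lemma solves_frac_ode_iff_volterra:
  assumes \<alpha>: "0 < \<alpha>" "\<alpha> < 1" and T: "0 < T"
    and \<psi>: "continuous_on {0..T} \<psi>" and f: "continuous_on {0..T} f"
  shows "solves_frac_ode \<alpha> T l \<psi> f b v \<longleftrightarrow> solves_frac_volterra \<alpha> T (\<lambda>t. l * \<psi> t) f b v"
proof
  assume "solves_frac_ode \<alpha> T l \<psi> f b v"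
  then obtain h where v: "continuous_on {0..T} v" "v 0 = b" and h: "continuous_on {0..T} h"
    and D: "has_caputo_deriv \<alpha> T v h" and eq: "\<And>t. t \<in> {0..T} \<Longrightarrow> h t + l * \<psi> t * v t = f t"
    unfolding solves_frac_ode_def by blast
  let ?J = "frac_int (1 - \<alpha>) (\<lambda>\<tau>. v \<tau> - v 0)"
  define z where "z = (\<lambda>t. (v t - v 0) - frac_int \<alpha> h t)"
  have z: "continuous_on {0..T} z"
    unfolding z_def using v h \<alpha> by (intro continuous_intros continuous_on_frac_int)
  have J: "?J t = integral {0..t} h" if t: "t \<in> {0..T}" for t
  proof -
    have "(h has_integral ?J t - ?J 0) {0..t}"
    proof (rule fundamental_theorem_of_calculus)
      fix x assume "x \<in> {0..t}"
      then have "(?J has_real_derivative h x) (at x within {0..T})"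
        using D t unfolding has_caputo_deriv_def by auto
      then show "(?J has_vector_derivative h x) (at x within {0..t})"
        using t by (auto simp: has_real_derivative_iff_has_vector_derivative
          intro: has_vector_derivative_within_subset)
    qed (use t in auto)
    then show ?thesis by (simp add: integral_unique)
  qed
  have "frac_int (1 - \<alpha>) z t = 0" if t: "t \<in> {0..T}" for t
  proof -
    have "frac_int (1 - \<alpha>) z t = ?J t - frac_int (1 - \<alpha>) (frac_int \<alpha> h) t"
      unfolding z_def using \<alpha> v h t
      by (intro frac_int_diff continuous_intros continuous_on_frac_int) auto
    then show ?thesis using J[OF t] frac_int_complement[OF \<alpha> h t] by simp
  qed
  then have "integral {0..t} z = 0" if t: "t \<in> {0..T}" for t
  proof -
    have "integral {0..t} z = frac_int \<alpha> (frac_int (1 - \<alpha>) z) t"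
      using frac_int_complement[of "1 - \<alpha>" T z t] \<alpha> z t by simp
    also have "\<dots> = frac_int \<alpha> (\<lambda>_. 0) t"
      using \<open>\<And>t. t \<in> {0..T} \<Longrightarrow> frac_int (1 - \<alpha>) z t = 0\<close> t by (intro frac_int_cong) auto
    finally show ?thesis by (simp add: frac_int_def)
  qed
  then have z0: "z t = 0" if "t \<in> {0..T}" for t
    using integral_zero_imp_zero[OF T z _ that] by simp
  have "v t = b + frac_int \<alpha> (\<lambda>s. f s - l * \<psi> s * v s) t" if t: "t \<in> {0..T}" for t
  proof -
    have "frac_int \<alpha> (\<lambda>s. f s - l * \<psi> s * v s) t = frac_int \<alpha> h t"
      using eq t by (intro frac_int_cong) (auto simp: algebra_simps)
    then show ?thesis using z0[OF t] v(2) by (simp add: z_def)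
  qed
  with v(1) show "solves_frac_volterra \<alpha> T (\<lambda>t. l * \<psi> t) f b v"
    by (simp add: solves_frac_volterra_def)
next
  assume "solves_frac_volterra \<alpha> T (\<lambda>t. l * \<psi> t) f b v"
  then have v: "continuous_on {0..T} v"
    and eq: "\<And>t. t \<in> {0..T} \<Longrightarrow> v t = b + frac_int \<alpha> (\<lambda>s. f s - l * \<psi> s * v s) t"
    by (auto simp: solves_frac_volterra_def)
  define h where "h = (\<lambda>s. f s - l * \<psi> s * v s)"
  have h: "continuous_on {0..T} h" unfolding h_def using v f \<psi> by (intro continuous_intros)
  have v0: "v 0 = b" using eq[of 0] T by simp
  have J: "frac_int (1 - \<alpha>) (\<lambda>\<tau>. v \<tau> - v 0) t = integral {0..t} h" if t: "t \<in> {0..T}" for t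
  proof -
    have "frac_int (1 - \<alpha>) (\<lambda>\<tau>. v \<tau> - v 0) t = frac_int (1 - \<alpha>) (frac_int \<alpha> h) t"
      using eq v0 t by (intro frac_int_cong) (auto simp: h_def)
    then show ?thesis using frac_int_complement[OF \<alpha> h t] by simp
  qed
  have "has_caputo_deriv \<alpha> T v h"
    unfolding has_caputo_deriv_def
  proof
    fix t assume t: "t \<in> {0..T}"
    show "(frac_int (1 - \<alpha>) (\<lambda>\<tau>. v \<tau> - v 0) has_real_derivative h t) (at t within {0..T})"
      by (rule has_field_derivative_transform_within[OF integral_has_real_derivative[OF h t] zero_less_one t])
         (simp add: J)
  qed
  then show "solves_frac_ode \<alpha> T l \<psi> f b v"
    unfolding solves_frac_ode_def using v v0 h by (auto simp: h_def intro!: exI[of _ h])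
qed

lemma frac_ode_sol_volterra:
  assumes \<alpha>: "0 < \<alpha>" "\<alpha> < 1" and T: "0 < T" and l: "0 < l" and \<psi>: "\<psi> \<in> Cplus T"
    and f: "continuous_on {0..T} f"
  shows "solves_frac_volterra \<alpha> T (\<lambda>t. l * \<psi> t) f b (frac_ode_sol \<alpha> T l \<psi> f b)"
proof -
  let ?V = "solves_frac_volterra \<alpha> T (\<lambda>t. l * \<psi> t) f b"
  have c: "continuous_on {0..T} \<psi>" using \<psi> by (simp add: Cplus_def)
  have q: "continuous_on {0..T} (\<lambda>t. l * \<psi> t)" "\<And>t. t \<in> {0..T} \<Longrightarrow> 0 < l * \<psi> t"
    using l \<psi> c by (auto simp: Cplus_def intro!: continuous_intros)
  note iff = solves_frac_ode_iff_volterra[OF \<alpha> T c f]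
  obtain v where "?V v" using solves_frac_volterra_exists[OF \<alpha>(1) less_imp_le[OF T] q(1) f] by blast
  then have "?V (restrict v {0..T})" by (subst solves_frac_volterra_cong) auto
  then have "\<exists>!v. v \<in> extensional {0..T} \<and> solves_frac_ode \<alpha> T l \<psi> f b v"
    unfolding iff
  proof (intro ex1I conjI; (elim conjE)?)
    fix w assume w: "w \<in> extensional {0..T}" "?V w" and r: "?V (restrict v {0..T})"
    show "w = restrict v {0..T}"
    proof (rule extensionalityI[OF w(1) restrict_extensional])
      fix t assume "t \<in> {0..T}"
      then show "w t = restrict v {0..T} t"
        using solves_frac_volterra_antimono[OF \<alpha> q q(1) f w(2) r] 
          solves_frac_volterra_antimono[OF \<alpha> q q(1) f r w(2)] by (intro antisym) auto
    qed
  qed auto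
  from theI'[OF this] show ?thesis unfolding frac_ode_sol_def iff by simp
qed


section \<open>The modes and the flux series\<close>

lemma L2_mult_integrable:
  assumes "u \<in> L2 \<Omega>" "v \<in> L2 \<Omega>"
  shows "integrable (lebesgue_on \<Omega>) (\<lambda>x. u x * v x)"
proof (rule Bochner_Integration.integrable_bound)
  show "integrable (lebesgue_on \<Omega>) (\<lambda>x. (u x)\<^sup>2 + (v x)\<^sup>2)"
    using assms unfolding L2_def by auto
  show "(\<lambda>x. u x * v x) \<in> borel_measurable (lebesgue_on \<Omega>)"
    using assms unfolding L2_def by auto
  have "\<bar>a * b\<bar> \<le> a\<^sup>2 + b\<^sup>2" for a b :: real
  proof -
    have "2 * (\<bar>a\<bar> * \<bar>b\<bar>) \<le> a\<^sup>2 + b\<^sup>2" using sum_squares_bound[of "\<bar>a\<bar>" "\<bar>b\<bar>"] by simp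
    moreover have "0 \<le> \<bar>a\<bar> * \<bar>b\<bar>" by simp
    ultimately show ?thesis unfolding abs_mult by linarith
  qed
  then show "AE x in lebesgue_on \<Omega>. norm (u x * v x) \<le> norm ((u x)\<^sup>2 + (v x)\<^sup>2)"
    by (intro AE_I2) simp
qed

lemma L2_diff:
  assumes "u \<in> L2 \<Omega>" "v \<in> L2 \<Omega>"
  shows "(\<lambda>x. u x - v x) \<in> L2 \<Omega>"
proof -
  have "integrable (lebesgue_on \<Omega>) (\<lambda>x. (u x)\<^sup>2 + (v x)\<^sup>2 - 2 * (u x * v x))"
    using assms L2_mult_integrable[OF assms] unfolding L2_def
    by (intro Bochner_Integration.integrable_diff Bochner_Integration.integrable_add integrable_mult_right) auto
  then show ?thesis using assms unfolding L2_def by (auto simp: power2_diff mult.assoc)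
qed

lemma L2_inner_diff_left:
  assumes "u \<in> L2 \<Omega>" "v \<in> L2 \<Omega>" "w \<in> L2 \<Omega>"
  shows "L2_inner \<Omega> (\<lambda>x. u x - v x) w = L2_inner \<Omega> u w - L2_inner \<Omega> v w"
  unfolding L2_inner_def left_diff_distrib
  using assms by (intro Bochner_Integration.integral_diff L2_mult_integrable)

lemma L2_inner_Cauchy_Schwarz:
  assumes u: "u \<in> L2 \<Omega>" and v: "v \<in> L2 \<Omega>"
  shows "\<bar>L2_inner \<Omega> u v\<bar> \<le> sqrt (L2_inner \<Omega> u u) * sqrt (L2_inner \<Omega> v v)"
proof -
  let ?M = "lebesgue_on \<Omega>"
  have sq: "(\<integral>\<^sup>+x. (ennreal \<bar>w x\<bar>)\<^sup>2 \<partial>?M) = ennreal (L2_inner \<Omega> w w)" if "w \<in> L2 \<Omega>" for w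
    using that unfolding L2_inner_def
    by (subst nn_integral_eq_integral[symmetric])
       (auto simp: L2_def ennreal_power power2_eq_square[symmetric])
  have "(ennreal (LINT x|?M. \<bar>u x * v x\<bar>))\<^sup>2 = (\<integral>\<^sup>+x. ennreal \<bar>u x\<bar> * ennreal \<bar>v x\<bar> \<partial>?M)\<^sup>2"
    using integrable_abs[OF L2_mult_integrable[OF u v]]
    by (subst nn_integral_eq_integral[symmetric]) (auto simp: ennreal_mult[symmetric] abs_mult)
  also have "\<dots> \<le> ennreal (L2_inner \<Omega> u u) * ennreal (L2_inner \<Omega> v v)"
    unfolding sq[OF u, symmetric] sq[OF v, symmetric]
    using u v by (intro Cauchy_Schwarz_nn_integral) (auto simp: L2_def)
  finally have "(LINT x|?M. \<bar>u x * v x\<bar>)\<^sup>2 \<le> L2_inner \<Omega> u u * L2_inner \<Omega> v v"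
    by (simp add: ennreal_power ennreal_mult[symmetric] L2_inner_def)
  then have "(LINT x|?M. \<bar>u x * v x\<bar>) \<le> sqrt (L2_inner \<Omega> u u * L2_inner \<Omega> v v)"
    by (rule real_le_rsqrt)
  moreover have "\<bar>L2_inner \<Omega> u v\<bar> \<le> (LINT x|?M. \<bar>u x * v x\<bar>)"
    unfolding L2_inner_def by (rule integral_abs_bound)
  ultimately show ?thesis by (simp add: real_sqrt_mult)
qed

lemma L2_norm_le_sobolev_norm:
  "sqrt (L2_inner \<Omega> u u) \<le> sobolev_norm k \<Omega> (u :: real^'d::finite \<Rightarrow> real)"
proof -
  have "finite {js :: 'd list. length js \<le> k}"
    using finite_lists_length_le[of "UNIV :: 'd set" k] by simp
  then have "L2_inner \<Omega> (weak_D \<Omega> [] u) (weak_D \<Omega> [] u) \<le>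
    (\<Sum>js\<in>{js. length js \<le> k}. L2_inner \<Omega> (weak_D \<Omega> js u) (weak_D \<Omega> js u))"
    by (intro member_le_sum) (auto simp: L2_inner_def)
  then show ?thesis by (simp add: sobolev_norm_def weak_D_def)
qed

lemma holder_continuous_L2_inner:
  assumes F: "holder_H3_H10 \<theta> T \<Omega> F" and "0 < \<theta>" and w: "w \<in> L2 \<Omega>"
  shows "continuous_on {0..T} (\<lambda>t. L2_inner \<Omega> (\<lambda>x. F x t) w)"
proof -
  obtain C where C: "\<And>s t. s \<in> {0..T} \<Longrightarrow> t \<in> {0..T} \<Longrightarrow>
      sobolev_norm 3 \<Omega> (\<lambda>x. F x t - F x s) \<le> C * \<bar>t - s\<bar> powr \<theta>"
    and L2: "\<And>t. t \<in> {0..T} \<Longrightarrow> (\<lambda>x. F x t) \<in> L2 \<Omega>"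
    using F unfolding holder_H3_H10_def sobolev_space_def by blast
  let ?K = "C * sqrt (L2_inner \<Omega> w w)"
  show ?thesis
    unfolding continuous_on_def
  proof
    fix s assume s: "s \<in> {0..T}"
    have "((\<lambda>t. \<bar>t - s\<bar>) \<longlongrightarrow> \<bar>s - s\<bar>) (at s within {0..T})" by (intro tendsto_intros)
    then have "((\<lambda>t. \<bar>t - s\<bar> powr \<theta>) \<longlongrightarrow> 0) (at s within {0..T})"
      using \<open>0 < \<theta>\<close> by (intro tendsto_zero_powrI[where b = \<theta>]) auto
    then have lim: "((\<lambda>t. ?K * \<bar>t - s\<bar> powr \<theta>) \<longlongrightarrow> 0) (at s within {0..T})"
      by (rule tendsto_mult_right_zero)
    have "\<forall>\<^sub>F t in at s within {0..T}.
      norm (L2_inner \<Omega> (\<lambda>x. F x t) w - L2_inner \<Omega> (\<lambda>x. F x s) w) \<le> ?K * \<bar>t - s\<bar> powr \<theta>"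
      unfolding eventually_at_filter
    proof (intro always_eventually allI impI)
      fix t assume t: "t \<in> {0..T}"
      let ?d = "\<lambda>x. F x t - F x s"
      have "norm (L2_inner \<Omega> (\<lambda>x. F x t) w - L2_inner \<Omega> (\<lambda>x. F x s) w) = \<bar>L2_inner \<Omega> ?d w\<bar>"
        using L2_inner_diff_left[OF L2[OF t] L2[OF s] w] by simp
      also have "\<dots> \<le> sqrt (L2_inner \<Omega> ?d ?d) * sqrt (L2_inner \<Omega> w w)"
        by (intro L2_inner_Cauchy_Schwarz L2_diff L2 s t w)
      also have "\<dots> \<le> (C * \<bar>t - s\<bar> powr \<theta>) * sqrt (L2_inner \<Omega> w w)"
        using order_trans[OF L2_norm_le_sobolev_norm C[OF s t]]
        by (intro mult_right_mono) (auto simp: L2_inner_def)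
      finally show "norm (L2_inner \<Omega> (\<lambda>x. F x t) w - L2_inner \<Omega> (\<lambda>x. F x s) w) \<le> ?K * \<bar>t - s\<bar> powr \<theta>"
        by (simp add: mult_ac)
    qed
    from Lim_null_comparison[OF this lim]
    show "((\<lambda>t. L2_inner \<Omega> (\<lambda>x. F x t) w) \<longlongrightarrow> L2_inner \<Omega> (\<lambda>x. F x s) w) (at s within {0..T})"
      by (rule LIM_zero_cancel)
  qed
qed

text \<open>The strict positivity of some \<open>f2 n\<close> matters: a vanishing second sum would make its quotient
  the junk value \<open>0\<close>.\<close>

lemma divide_suminf_ereal_antimono:
  fixes f1 f2 :: "nat \<Rightarrow> real"
  assumes "0 \<le> c" and f2: "\<And>n. 0 \<le> f2 n" and le: "\<And>n. f2 n \<le> f1 n" and N: "0 < f2 N"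
  shows "c / real_of_ereal (\<Sum>n. ereal (f1 n)) \<le> c / real_of_ereal (\<Sum>n. ereal (f2 n))"
proof -
  let ?S1 = "\<Sum>n. ereal (f1 n)" and ?S2 = "\<Sum>n. ereal (f2 n)"
  have le': "?S2 \<le> ?S1" using f2 le by (intro suminf_le_pos) auto
  have "ereal (f2 N) \<le> (\<Sum>n<Suc N. ereal (f2 n))"
    using f2 by (simp add: sum_nonneg)
  also have "\<dots> \<le> ?S2" using f2 by (intro suminf_upper) auto
  finally have pos: "0 < ?S2" using N by (metis ereal_less(2) order_less_le_trans)
  show ?thesis
  proof (cases ?S1)
    case (real r1)
    then obtain r2 where "?S2 = ereal r2" using le' pos by (cases ?S2) auto
    then show ?thesis using real le' pos \<open>0 \<le> c\<close> by (simp add: divide_left_mono)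
  next
    case PInf
    then show ?thesis using pos \<open>0 \<le> c\<close> by (simp add: real_of_ereal_pos)
  next
    case MInf
    then show ?thesis using le' pos by auto
  qed
qed

theorem theorem4p2:
  fixes \<alpha> T :: real
    and \<Omega> :: "(real^'d::finite) set" and x0 :: "real^'d"
    and a :: "'d \<Rightarrow> 'd \<Rightarrow> real^'d \<Rightarrow> real" and c :: "real^'d \<Rightarrow> real"
    and lam :: "nat \<Rightarrow> real" and \<phi> :: "nat \<Rightarrow> real^'d \<Rightarrow> real"
    and u0 :: "real^'d \<Rightarrow> real" and F :: "real^'d \<Rightarrow> real \<Rightarrow> real"
    and g a1 a2 :: "real \<Rightarrow> real"
  assumes "CARD('d) \<in> {1, 2, 3}" and "T > 0" and "\<alpha> \<in> {0<..<1}"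
    and "C3_domain \<Omega>" and "x0 \<in> frontier \<Omega>"
    and "elliptic_coeffs \<Omega> a c"
    and "dirichlet_eigensystem \<Omega> a c x0 lam \<phi>"
    and u0: "u0 \<in> sobolev_space 3 \<Omega> \<inter> H10 \<Omega>" "\<forall>n. L2_inner \<Omega> u0 (\<phi> n) \<ge> 0"
    and F: "\<exists>\<theta>\<in>{0<..<1}. holder_H3_H10 \<theta> T \<Omega> F"
      "\<forall>n. \<forall>t\<in>{0..T}. L2_inner \<Omega> (\<lambda>x. F x t) (\<phi> n) \<ge> 0"
    and N: "\<exists>N. normal_derivative \<Omega> x0 (\<phi> N) > 0 \<and> L2_inner \<Omega> u0 (\<phi> N) > 0 \<and>
      (\<forall>t\<in>{0..T}. L2_inner \<Omega> (\<lambda>x. F x t) (\<phi> N) > 0)"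
    and g: "g \<in> Cplus T"
    and "a1 \<in> K_domain \<alpha> T \<Omega> x0 u0 F g" and "a2 \<in> K_domain \<alpha> T \<Omega> x0 u0 F g"
    and "\<forall>t\<in>{0..T}. a1 t \<le> a2 t"
  shows "\<forall>t\<in>{0..T}. K_op \<alpha> T \<Omega> x0 lam \<phi> u0 F g a1 t \<le> K_op \<alpha> T \<Omega> x0 lam \<phi> u0 F g a2 t"
proof
  fix t assume t: "t \<in> {0..T}"
  have \<alpha>: "0 < \<alpha>" "\<alpha> < 1" using \<open>\<alpha> \<in> {0<..<1}\<close> by auto
  have es: "0 < lam 0" "incseq lam" "\<And>n. \<phi> n \<in> L2 \<Omega>" and D: "\<And>n. 0 \<le> normal_derivative \<Omega> x0 (\<phi> n)"
    using \<open>dirichlet_eigensystem \<Omega> a c x0 lam \<phi>\<close>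
    unfolding dirichlet_eigensystem_def orthonormal_basis_L2_def by auto
  have lam: "0 < lam n" for n using es(1) incseqD[OF es(2), of 0 n] by simp
  have a1: "a1 \<in> Cplus T" and a2: "a2 \<in> Cplus T"
    using \<open>a1 \<in> K_domain \<alpha> T \<Omega> x0 u0 F g\<close> \<open>a2 \<in> K_domain \<alpha> T \<Omega> x0 u0 F g\<close> by (auto simp: K_domain_def)
  let ?f = "\<lambda>n t. L2_inner \<Omega> (\<lambda>x. F x t) (\<phi> n)" and ?b = "\<lambda>n. L2_inner \<Omega> u0 (\<phi> n)"
  let ?u = "\<lambda>n \<psi>. u_mode \<alpha> T \<Omega> lam \<phi> u0 F n \<psi>"
  have f: "continuous_on {0..T} (?f n)" for n
    using F(1) es(3) by (auto intro: holder_continuous_L2_inner)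
  have q: "continuous_on {0..T} (\<lambda>t. lam n * \<psi> t)" "\<And>t. t \<in> {0..T} \<Longrightarrow> 0 < lam n * \<psi> t"
    if "\<psi> \<in> Cplus T" for \<psi> n
    using that lam[of n] by (auto simp: Cplus_def intro!: continuous_intros)
  have sol: "solves_frac_volterra \<alpha> T (\<lambda>t. lam n * \<psi> t) (?f n) (?b n) (?u n \<psi>)" if "\<psi> \<in> Cplus T" for \<psi> n
    unfolding u_mode_def by (rule frac_ode_sol_volterra[OF \<alpha> \<open>0 < T\<close> lam that f])
  have nonneg: "0 \<le> ?u n a2 t" if "t \<in> {0..T}" for n t
    using F(2) u0(2) that
    by (intro solves_frac_volterra_nonneg[OF \<alpha> q[OF a2] f _ _ sol[OF a2]]) auto
  have le: "?u n a2 t \<le> ?u n a1 t" for n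
  proof (rule solves_frac_volterra_antimono[OF \<alpha> q[OF a1] q(1)[OF a2] f sol[OF a1] sol[OF a2] _ t])
    show "lam n * a1 s * ?u n a2 s \<le> lam n * a2 s * ?u n a2 s" if "s \<in> {0..T}" for s
      using that nonneg[OF that] lam[of n] \<open>\<forall>t\<in>{0..T}. a1 t \<le> a2 t\<close>
      by (intro mult_right_mono mult_left_mono) auto
  qed
  obtain N where N: "0 < normal_derivative \<Omega> x0 (\<phi> N)" "0 < ?b N" "\<And>t. t \<in> {0..T} \<Longrightarrow> 0 < ?f N t"
    using N by blast
  have "0 < ?u N a2 t"
    by (rule solves_frac_volterra_pos[OF \<alpha> q(1)[OF a2] f N(3,2) sol[OF a2] t])
  moreover have "0 \<le> g t" using g t by (auto simp: Cplus_def less_imp_le)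
  ultimately show "K_op \<alpha> T \<Omega> x0 lam \<phi> u0 F g a1 t \<le> K_op \<alpha> T \<Omega> x0 lam \<phi> u0 F g a2 t"
    unfolding K_op_def using D N(1) nonneg[OF t] le
    by (intro divide_suminf_ereal_antimono[where N = N] mult_nonneg_nonneg mult_right_mono mult_pos_pos) auto
qed

end
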